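(* Let $P$ be any profile with $n\ge 5$ agents and houses. Then $|\mathit{TC}(P)|\in\{1,2,n!-2,n!-1,n!\}$. More precisely: (i) $|\mathit{TC}(P)|=1$ if all agents have pairwise distinct top choices; (ii) $|\mathit{TC}(P)|=2$ if all but two agents have distinct top choices (i.e., there are distinct agents $x,y$ with the same top choice $p$, while the top choices of the agents in $N\setminus\{y\}$ are pairwise distinct), and these two agents $x,y$ also share the same second choice $q$, which is not top-ranked by any other agent; (iii) $|\mathit{TC}(P)|=n!-2$ if the conditions in (i) and (ii) do not hold, and all but two agents have distinct bottom choices (i.e., there are distinct agents $x,y$ with the same last-ranked house $p$, while the last-ranked houses of the agents in $N\setminus\{y\}$ are pairwise distinct), and these two agents also share the same second-to-last ranked house $q$, which is not last-ranked by any other agent; (iv) $|\mathit{TC}(P)|=n!-1$ if the conditions in (i) and (ii) do not hold, and all agents have pairwise distinct bottom (last-ranked) choices; (v) $|\mathit{TC}(P)|=n!$ if none of the conditions in (i)–(iv) holds.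
   Context: Let $N=\{1,\dots,n\}$ be agents and $H$ a set of $n$ houses. A profile $P=(\succ_1,\dots,\succ_n)$ gives each agent a strict linear order on $H$; an agent's top (bottom) choice is the house she ranks first (last). An assignment is a bijection $\mu:N\to H$; $M$ is the set of all $n!$ assignments. Agent $x$ weakly prefers $\mu$ to $\lambda$ if $\mu(x)\succ_x\lambda(x)$ or $\mu(x)=\lambda(x)$. $N_{\mu,\lambda}$ is the set of agents weakly preferring $\mu$ to $\lambda$; $\mu\succsim\lambda$ if $|N_{\mu,\lambda}|\ge|N_{\lambda,\mu}|$, and $\succsim^*$ is the transitive closure of $\succsim$. The top cycle is $\mathit{TC}(P)=\{\mu\in M:\mu\succsim^*\lambda\text{ for all }\lambda\in M\}$. *)

theory Defs
  imports Main
begin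

text \<open>Agents are 1..n (natural numbers); houses form a finite set H of some type 'h
with n elements. A profile P assigns to each agent i a strict linear order P i on H,
given as a relation: (a, b) \<in> P i means agent i strictly prefers a to b.\<close>

definition agents :: "nat \<Rightarrow> nat set" where
  "agents n = {1..n}"

definition is_profile :: "nat \<Rightarrow> 'h set \<Rightarrow> (nat \<Rightarrow> ('h \<times> 'h) set) \<Rightarrow> bool" where
  "is_profile n H P \<longleftrightarrow> finite H \<and> card H = n \<and>
     (\<forall>i \<in> agents n. P i \<subseteq> H \<times> H \<and> strict_linear_order_on H (P i))"

definition top_of :: "('h \<times> 'h) set \<Rightarrow> 'h set \<Rightarrow> 'h" where
  "top_of R A = (THE t. t \<in> A \<and> (\<forall>h\<in>A. h \<noteq> t \<longrightarrow> (t, h) \<in> R))"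

definition bot_of :: "('h \<times> 'h) set \<Rightarrow> 'h set \<Rightarrow> 'h" where
  "bot_of R A = (THE t. t \<in> A \<and> (\<forall>h\<in>A. h \<noteq> t \<longrightarrow> (h, t) \<in> R))"

definition top_choice :: "'h set \<Rightarrow> (nat \<Rightarrow> ('h \<times> 'h) set) \<Rightarrow> nat \<Rightarrow> 'h" where
  "top_choice H P i = top_of (P i) H"

definition second_choice :: "'h set \<Rightarrow> (nat \<Rightarrow> ('h \<times> 'h) set) \<Rightarrow> nat \<Rightarrow> 'h" where
  "second_choice H P i = top_of (P i) (H - {top_choice H P i})"

definition bottom_choice :: "'h set \<Rightarrow> (nat \<Rightarrow> ('h \<times> 'h) set) \<Rightarrow> nat \<Rightarrow> 'h" where
  "bottom_choice H P i = bot_of (P i) H"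

definition second_last_choice :: "'h set \<Rightarrow> (nat \<Rightarrow> ('h \<times> 'h) set) \<Rightarrow> nat \<Rightarrow> 'h" where
  "second_last_choice H P i = bot_of (P i) (H - {bottom_choice H P i})"

definition assignments :: "nat \<Rightarrow> 'h set \<Rightarrow> (nat \<Rightarrow> 'h) set" where
  "assignments n H = {\<mu>. bij_betw \<mu> (agents n) H \<and> (\<forall>x. x \<notin> agents n \<longrightarrow> \<mu> x = undefined)}"

definition weak_pref_agents ::
  "nat \<Rightarrow> (nat \<Rightarrow> ('h \<times> 'h) set) \<Rightarrow> (nat \<Rightarrow> 'h) \<Rightarrow> (nat \<Rightarrow> 'h) \<Rightarrow> nat set" where
  "weak_pref_agents n P \<mu> \<nu> = {x \<in> agents n. (\<mu> x, \<nu> x) \<in> P x \<or> \<mu> x = \<nu> x}"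

definition maj_rel :: "nat \<Rightarrow> 'h set \<Rightarrow> (nat \<Rightarrow> ('h \<times> 'h) set) \<Rightarrow> ((nat \<Rightarrow> 'h) \<times> (nat \<Rightarrow> 'h)) set" where
  "maj_rel n H P = {(\<mu>, \<nu>). \<mu> \<in> assignments n H \<and> \<nu> \<in> assignments n H \<and>
      card (weak_pref_agents n P \<mu> \<nu>) \<ge> card (weak_pref_agents n P \<nu> \<mu>)}"

definition top_cycle :: "nat \<Rightarrow> 'h set \<Rightarrow> (nat \<Rightarrow> ('h \<times> 'h) set) \<Rightarrow> (nat \<Rightarrow> 'h) set" where
  "top_cycle n H P = {\<mu> \<in> assignments n H. \<forall>\<nu> \<in> assignments n H. (\<mu>, \<nu>) \<in> (maj_rel n H P)\<^sup>+}"

definition cond_i :: "nat \<Rightarrow> 'h set \<Rightarrow> (nat \<Rightarrow> ('h \<times> 'h) set) \<Rightarrow> bool" where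
  "cond_i n H P \<longleftrightarrow> inj_on (top_choice H P) (agents n)"

definition cond_ii :: "nat \<Rightarrow> 'h set \<Rightarrow> (nat \<Rightarrow> ('h \<times> 'h) set) \<Rightarrow> bool" where
  "cond_ii n H P \<longleftrightarrow> (\<exists>x y p q. x \<in> agents n \<and> y \<in> agents n \<and> x \<noteq> y \<and>
      top_choice H P x = p \<and> top_choice H P y = p \<and>
      inj_on (top_choice H P) (agents n - {y}) \<and>
      second_choice H P x = q \<and> second_choice H P y = q \<and>
      (\<forall>z \<in> agents n - {x, y}. top_choice H P z \<noteq> q))"

definition cond_iii :: "nat \<Rightarrow> 'h set \<Rightarrow> (nat \<Rightarrow> ('h \<times> 'h) set) \<Rightarrow> bool" where
  "cond_iii n H P \<longleftrightarrow> (\<exists>x y p q. x \<in> agents n \<and> y \<in> agents n \<and> x \<noteq> y \<and>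
      bottom_choice H P x = p \<and> bottom_choice H P y = p \<and>
      inj_on (bottom_choice H P) (agents n - {y}) \<and>
      second_last_choice H P x = q \<and> second_last_choice H P y = q \<and>
      (\<forall>z \<in> agents n - {x, y}. bottom_choice H P z \<noteq> q))"

definition cond_iv :: "nat \<Rightarrow> 'h set \<Rightarrow> (nat \<Rightarrow> ('h \<times> 'h) set) \<Rightarrow> bool" where
  "cond_iv n H P \<longleftrightarrow> inj_on (bottom_choice H P) (agents n)"

end

(* The top cycle strictly beats its complement; call its members winners and the other assignments
   losers. For a set T of three agents, the coset of an assignment consists of the six assignments
   obtained by permuting the houses of T. Swapping an agent outside T with one in T cannot turn a
   coset having at least three winners into one having at least three losers (a finite check on four
   agents), so for fixed T either every coset has at most two losers or every coset has at most two
   winners; double counting makes the alternative independent of T. If every coset has at most two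
   losers, then from a losing assignment each agent has at most one swap to another losing
   assignment, which forces every agent to sit at her last house, except possibly one agent at her
   second-to-last. Hence there are at most two losers, of the shape described by (iii) and (iv).
   Reversing all preferences exchanges winners with losers and gives (i) and (ii). *)

theory Submission
  imports Defs "HOL-Combinatorics.Permutations"
begin

section \<open>Finite check on four agents\<close>

text \<open>At most three of the six fail, so any four include one that holds. The fifteen clauses
  put the counting hypotheses of \<open>four_agents\<close> into propositional form.\<close>

lemma three_of_six:
  assumes "3 \<le> (of_bool p + of_bool q + of_bool r + of_bool s + of_bool t + of_bool u :: nat)"
  shows "(p \<or> q \<or> r \<or> s) \<and> (p \<or> q \<or> r \<or> t) \<and> (p \<or> q \<or> r \<or> u) \<and> (p \<or> q \<or> s \<or> t) \<and>
    (p \<or> q \<or> s \<or> u) \<and> (p \<or> q \<or> t \<or> u) \<and> (p \<or> r \<or> s \<or> t) \<and> (p \<or> r \<or> s \<or> u) \<and>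
    (p \<or> r \<or> t \<or> u) \<and> (p \<or> s \<or> t \<or> u) \<and> (q \<or> r \<or> s \<or> t) \<and> (q \<or> r \<or> s \<or> u) \<and>
    (q \<or> r \<or> t \<or> u) \<and> (q \<or> s \<or> t \<or> u) \<and> (r \<or> s \<or> t \<or> u)"
  using assms by (cases p; cases q; cases r; cases s; cases t; cases u) simp_all

text \<open>The predicate \<open>A\<close> marks those distributions of four houses among four agents that lie on
  the winning side; \<open>p\<close>, \<open>q\<close>, \<open>r\<close>, \<open>s\<close> are the preferences of the four agents. Comparing only
  distributions that differ by a swap or by a derangement already leads to a finite
  propositional contradiction.\<close>

lemma four_agents:
  fixes A :: "'h \<Rightarrow> 'h \<Rightarrow> 'h \<Rightarrow> 'h \<Rightarrow> bool" and p q r s :: "'h \<Rightarrow> 'h \<Rightarrow> bool"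
  assumes dist: "distinct [a, b, c, d]"
    and total: "\<And>g h. \<lbrakk>g \<in> {a, b, c, d}; h \<in> {a, b, c, d}; g \<noteq> h\<rbrakk> \<Longrightarrow>
      (\<not> p g h) = p h g \<and> (\<not> q g h) = q h g \<and> (\<not> r g h) = r h g \<and> (\<not> s g h) = s h g"
    and wins: "\<And>g h k l g' h' k' l'. \<lbrakk>distinct [g, h, k, l]; {g, h, k, l} = {a, b, c, d};
      distinct [g', h', k', l']; {g', h', k', l'} = {a, b, c, d}; A g h k l; \<not> A g' h' k' l'\<rbrakk> \<Longrightarrow>
      (of_bool (p g' g) + of_bool (q h' h) + of_bool (r k' k) + of_bool (s l' l) :: nat)
      < of_bool (p g g') + of_bool (q h h') + of_bool (r k k') + of_bool (s l l')"
    and A: "3 \<le> (of_bool (A a b c d) + of_bool (A a b d c) + of_bool (A a c b d)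
      + of_bool (A a c d b) + of_bool (A a d b c) + of_bool (A a d c b) :: nat)"
    and B: "3 \<le> (of_bool (\<not> A b a c d) + of_bool (\<not> A b a d c) + of_bool (\<not> A b c a d)
      + of_bool (\<not> A b c d a) + of_bool (\<not> A b d a c) + of_bool (\<not> A b d c a) :: nat)"
  shows False
proof -
  \<comment> \<open>At least three of four hold exactly if no two fail.\<close>
  define most where "most P Q R S \<longleftrightarrow>
    (P \<or> Q) \<and> (P \<or> R) \<and> (P \<or> S) \<and> (Q \<or> R) \<and> (Q \<or> S) \<and> (R \<or> S)" for P Q R S
  have two: "(of_bool (\<not> P) + of_bool (\<not> Q) < (of_bool P + of_bool Q :: nat)) = (P \<and> Q)" for P Q
    by (cases P; cases Q) simp_all
  have four: "(of_bool (\<not> P) + of_bool (\<not> Q) + of_bool (\<not> R) + of_bool (\<not> S)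
      < (of_bool P + of_bool Q + of_bool R + of_bool S :: nat)) = most P Q R S" for P Q R S
    unfolding most_def by (cases P; cases Q; cases R; cases S) simp_all
  \<comment> \<open>The fifteen targets are the six swaps and the nine derangements of a winning
    distribution. A target that is not winning loses to it: both agents moved by the swap object, or
    at least three of the four moved by the derangement.\<close>
  have rules: "A g h k l \<longrightarrow>
      (A h g k l \<or> p g h \<and> q h g) \<and> (A k h g l \<or> p g k \<and> r k g) \<and> (A l h k g \<or> p g l \<and> s l g) \<and>
      (A g k h l \<or> q h k \<and> r k h) \<and> (A g l k h \<or> q h l \<and> s l h) \<and> (A g h l k \<or> r k l \<and> s l k) \<and>
      (A h g l k \<or> most (p g h) (q h g) (r k l) (s l k)) \<and>
      (A h k l g \<or> most (p g h) (q h k) (r k l) (s l g)) \<and>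
      (A h l g k \<or> most (p g h) (q h l) (r k g) (s l k)) \<and>
      (A k g l h \<or> most (p g k) (q h g) (r k l) (s l h)) \<and>
      (A k l g h \<or> most (p g k) (q h l) (r k g) (s l h)) \<and>
      (A k l h g \<or> most (p g k) (q h l) (r k h) (s l g)) \<and>
      (A l g h k \<or> most (p g l) (q h g) (r k h) (s l k)) \<and>
      (A l k g h \<or> most (p g l) (q h k) (r k g) (s l h)) \<and>
      (A l k h g \<or> most (p g l) (q h k) (r k h) (s l g))"
    if gh: "distinct [g, h, k, l]" "{g, h, k, l} = {a, b, c, d}" for g h k l
  proof
    assume Ag: "A g h k l"
    have ne: "g \<noteq> h" "g \<noteq> k" "g \<noteq> l" "h \<noteq> k" "h \<noteq> l" "k \<noteq> l"
      using gh(1) by auto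
    \<comment> \<open>Irreflexivity is not among the hypotheses. The guard
      \<open>u \<noteq> v\<close> removes unmoved agents, whose terms on the two sides of
      \<open>wins\<close> coincide and cancel.\<close>
    let ?b = "\<lambda>p u v. of_bool (u \<noteq> v \<and> p u v) :: nat"
    have swap_terms: "of_bool (p v u) + ?b p u v = of_bool (p u v) + ?b (\<lambda>u v. \<not> p u v) u v"
      "of_bool (q v u) + ?b q u v = of_bool (q u v) + ?b (\<lambda>u v. \<not> q u v) u v"
      "of_bool (r v u) + ?b r u v = of_bool (r u v) + ?b (\<lambda>u v. \<not> r u v) u v"
      "of_bool (s v u) + ?b s u v = of_bool (s u v) + ?b (\<lambda>u v. \<not> s u v) u v"
      if "u \<in> {g, h, k, l}" "v \<in> {g, h, k, l}" for u v
      using total[OF that[unfolded gh(2)]] by (cases "u = v"; simp; metis)+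
    have key: "A g' h' k' l' \<or>
        ?b (\<lambda>u v. \<not> p u v) g g' + ?b (\<lambda>u v. \<not> q u v) h h' + ?b (\<lambda>u v. \<not> r u v) k k' + ?b (\<lambda>u v. \<not> s u v) l l'
        < ?b p g g' + ?b q h h' + ?b r k k' + ?b s l l'"
      if gh': "distinct [g', h', k', l']" "{g', h', k', l'} = {g, h, k, l}" for g' h' k' l'
    proof (cases "A g' h' k' l'")
      case False
      have "g' \<in> {g, h, k, l}" "h' \<in> {g, h, k, l}" "k' \<in> {g, h, k, l}" "l' \<in> {g, h, k, l}"
        using gh'(2) by blast+
      then have "of_bool (p g' g) + ?b p g g' = of_bool (p g g') + ?b (\<lambda>u v. \<not> p u v) g g'"
        "of_bool (q h' h) + ?b q h h' = of_bool (q h h') + ?b (\<lambda>u v. \<not> q u v) h h'"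
        "of_bool (r k' k) + ?b r k k' = of_bool (r k k') + ?b (\<lambda>u v. \<not> r u v) k k'"
        "of_bool (s l' l) + ?b s l l' = of_bool (s l l') + ?b (\<lambda>u v. \<not> s u v) l l'"
        by (intro swap_terms; blast)+
      then show ?thesis
        using wins[OF gh(1,2) gh'(1) gh'(2)[unfolded gh(2)] Ag False] by linarith
    qed simp
    show "(A h g k l \<or> p g h \<and> q h g) \<and> (A k h g l \<or> p g k \<and> r k g) \<and> (A l h k g \<or> p g l \<and> s l g) \<and>
      (A g k h l \<or> q h k \<and> r k h) \<and> (A g l k h \<or> q h l \<and> s l h) \<and> (A g h l k \<or> r k l \<and> s l k) \<and>
      (A h g l k \<or> most (p g h) (q h g) (r k l) (s l k)) \<and>
      (A h k l g \<or> most (p g h) (q h k) (r k l) (s l g)) \<and>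
      (A h l g k \<or> most (p g h) (q h l) (r k g) (s l k)) \<and>
      (A k g l h \<or> most (p g k) (q h g) (r k l) (s l h)) \<and>
      (A k l g h \<or> most (p g k) (q h l) (r k g) (s l h)) \<and>
      (A k l h g \<or> most (p g k) (q h l) (r k h) (s l g)) \<and>
      (A l g h k \<or> most (p g l) (q h g) (r k h) (s l k)) \<and>
      (A l k g h \<or> most (p g l) (q h k) (r k g) (s l h)) \<and>
      (A l k h g \<or> most (p g l) (q h k) (r k h) (s l g))"
      using key[of h g k l] key[of k h g l] key[of l h k g] key[of g k h l] key[of g l k h]
        key[of g h l k] key[of h g l k] key[of h k l g] key[of h l g k] key[of k g l h]
        key[of k l g h] key[of k l h g] key[of l g h k] key[of l k g h] key[of l k h g]
      by (simp add: ne ne[symmetric] two four insert_commute)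
  qed
  have ne [simp]: "a \<noteq> b" "a \<noteq> c" "a \<noteq> d" "b \<noteq> c" "b \<noteq> d" "c \<noteq> d"
    using dist by auto
  note ne [symmetric, simp]
  note facts = rules[of a b c d] rules[of a b d c] rules[of a c b d] rules[of a c d b] rules[of a d b c]
    rules[of a d c b] rules[of b a c d] rules[of b a d c] rules[of b c a d] rules[of b c d a]
    rules[of b d a c] rules[of b d c a] rules[of c a b d] rules[of c a d b] rules[of c b a d]
    rules[of c b d a] rules[of c d a b] rules[of c d b a] rules[of d a b c] rules[of d a c b]
    rules[of d b a c] rules[of d b c a] rules[of d c a b] rules[of d c b a]
  note facts' = facts[simplified insert_commute, simplified]
  \<comment> \<open>Totality turns each agent's preference over a pair of houses into a single
    propositional atom.\<close>
  have asym: "(\<not> p g h) = p h g \<and> (\<not> q g h) = q h g \<and> (\<not> r g h) = r h g \<and> (\<not> s g h) = s h g"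
    if "(g, h) \<in> set [(a, b), (a, c), (a, d), (b, c), (b, d), (c, d)]" for g h
    by (rule total) (use that ne in auto)
  show False
    using three_of_six[OF A] three_of_six[OF B] facts'
      asym[of a b, simplified] asym[of a c, simplified] asym[of a d, simplified]
      asym[of b c, simplified] asym[of b d, simplified] asym[of c d, simplified]
    unfolding most_def
    by sat
qed

section \<open>Profiles, assignments, swaps and cosets\<close>

locale preference_profile =
  fixes n :: nat and H :: "'h set" and P :: "nat \<Rightarrow> ('h \<times> 'h) set"
  assumes profile: "is_profile n H P"
begin

abbreviation "N \<equiv> agents n"
abbreviation "M \<equiv> assignments n H"

text \<open>Agents with the same house in both assignments count on both sides of a majority
  comparison, so strict preferences decide it; see \<open>maj_rel_iff\<close>.\<close>

definition wins :: "(nat \<Rightarrow> 'h) \<Rightarrow> (nat \<Rightarrow> 'h) \<Rightarrow> nat" where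
  "wins \<mu> \<nu> = card {x \<in> N. (\<mu> x, \<nu> x) \<in> P x}"

definition swap :: "nat \<Rightarrow> nat \<Rightarrow> (nat \<Rightarrow> 'h) \<Rightarrow> nat \<Rightarrow> 'h" where
  "swap x y \<mu> = \<mu>(x := \<mu> y, y := \<mu> x)"

text \<open>For \<mu> in \<open>M\<close> this is the orbit of \<mu> under permutations of the
  agents in \<open>T\<close>, described without composing functions.\<close>

definition coset :: "(nat \<Rightarrow> 'h) \<Rightarrow> nat set \<Rightarrow> (nat \<Rightarrow> 'h) set" where
  "coset \<mu> T = {\<nu> \<in> M. \<forall>i. i \<notin> T \<longrightarrow> \<nu> i = \<mu> i}"

lemma finite_agents [simp]: "finite N"
  by (simp add: agents_def)

lemma card_agents: "card N = n"
  by (simp add: agents_def)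

lemma finite_houses [simp]: "finite H"
  using profile by (simp add: is_profile_def)

lemma card_houses: "card H = n"
  using profile by (simp add: is_profile_def)

lemma pref_irrefl [simp]: "x \<in> N \<Longrightarrow> (h, h) \<notin> P x"
  using profile by (auto simp: is_profile_def strict_linear_order_on_def irrefl_def)

lemma not_pref_iff: "\<lbrakk>x \<in> N; g \<in> H; h \<in> H; g \<noteq> h\<rbrakk> \<Longrightarrow> (g, h) \<notin> P x \<longleftrightarrow> (h, g) \<in> P x"
  using profile unfolding is_profile_def strict_linear_order_on_def
  by (meson irreflD total_on_def transE)

lemma pref_trans: "\<lbrakk>x \<in> N; (g, h) \<in> P x; (h, k) \<in> P x\<rbrakk> \<Longrightarrow> (g, k) \<in> P x"
  using profile unfolding is_profile_def strict_linear_order_on_def by (meson transE)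

lemma pref_asym: "\<lbrakk>x \<in> N; (g, h) \<in> P x\<rbrakk> \<Longrightarrow> (h, g) \<notin> P x"
  using pref_irrefl pref_trans by blast

lemma assignment_inj: "\<mu> \<in> M \<Longrightarrow> inj_on \<mu> N"
  by (simp add: assignments_def bij_betw_def)

lemma assignment_image: "\<mu> \<in> M \<Longrightarrow> \<mu> ` N = H"
  by (simp add: assignments_def bij_betw_def)

lemma assignment_in_houses [simp]: "\<mu> \<in> M \<Longrightarrow> x \<in> N \<Longrightarrow> \<mu> x \<in> H"
  using assignment_image by blast

lemma assignment_eq_iff: "\<lbrakk>\<mu> \<in> M; x \<in> N; y \<in> N\<rbrakk> \<Longrightarrow> \<mu> x = \<mu> y \<longleftrightarrow> x = y"
  using assignment_inj by (auto dest: inj_onD)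

lemma assignment_undefined: "\<mu> \<in> M \<Longrightarrow> x \<notin> N \<Longrightarrow> \<mu> x = undefined"
  by (simp add: assignments_def)

lemma assignment_eqI: "\<lbrakk>\<mu> \<in> M; \<nu> \<in> M; \<And>x. x \<in> N \<Longrightarrow> \<mu> x = \<nu> x\<rbrakk> \<Longrightarrow> \<mu> = \<nu>"
  using assignment_undefined by (metis ext)

text \<open>Surjectivity suffices because \<open>N\<close> and \<open>H\<close> both have
  \<open>n\<close> elements.\<close>

lemma assignmentI: "\<lbrakk>\<mu> ` N = H; \<And>x. x \<notin> N \<Longrightarrow> \<mu> x = undefined\<rbrakk> \<Longrightarrow> \<mu> \<in> M"
  by (simp add: assignments_def bij_betw_def eq_card_imp_inj_on card_agents card_houses)

text \<open>The houses held in \<open>T\<close> are only redistributed within \<open>T\<close>, so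
  the image of \<open>N\<close> is still \<open>H\<close>. Swaps and the updates in cosets are
  instances.\<close>

lemma reassign:
  assumes "\<mu> \<in> M" "T \<subseteq> N" "\<nu> ` T = \<mu> ` T" "\<And>i. i \<notin> T \<Longrightarrow> \<nu> i = \<mu> i"
  shows "\<nu> \<in> M"
proof (rule assignmentI)
  have "\<nu> ` N = \<nu> ` T \<union> \<nu> ` (N - T)"
    using assms(2) by blast
  also have "\<nu> ` (N - T) = \<mu> ` (N - T)"
    using assms(4) by (intro image_cong) auto
  also have "\<nu> ` T \<union> \<mu> ` (N - T) = \<mu> ` N"
    using assms(2,3) by blast
  finally show "\<nu> ` N = H"
    using assignment_image[OF assms(1)] by simp
  show "\<nu> x = undefined" if "x \<notin> N" for x
    using that assms(2,4) assignment_undefined[OF assms(1)] by (metis subsetD)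
qed

lemma finite_assignments: "finite M"
proof (rule finite_subset)
  show "M \<subseteq> {f. \<forall>x. (x \<in> N \<longrightarrow> f x \<in> H) \<and> (x \<notin> N \<longrightarrow> f x = undefined)}"
    using assignment_undefined by auto
qed (rule finite_set_of_finite_funs; simp)

lemma swap_assignment [simp]: "\<lbrakk>\<mu> \<in> M; x \<in> N; y \<in> N\<rbrakk> \<Longrightarrow> swap x y \<mu> \<in> M"
  by (rule reassign[where \<mu> = \<mu> and T = "{x, y}"]) (auto simp: swap_def)

lemma swap_simps [simp]:
  "swap x y \<mu> x = \<mu> y" "swap x y \<mu> y = \<mu> x" "\<lbrakk>z \<noteq> x; z \<noteq> y\<rbrakk> \<Longrightarrow> swap x y \<mu> z = \<mu> z"
  by (auto simp: swap_def)

lemma swap_swap [simp]: "swap x y (swap x y \<mu>) = \<mu>"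
  by (auto simp: swap_def)

lemma swap_commute: "swap x y \<mu> = swap y x \<mu>"
  by (auto simp: swap_def)

text \<open>Agents outside \<open>D\<close> hold the same house twice and drop out by irreflexivity,
  so local changes are compared by the votes of the moved agents alone.\<close>

lemma wins_eq_sum:
  assumes "D \<subseteq> N" "\<And>i. i \<in> N - D \<Longrightarrow> \<mu> i = \<nu> i"
  shows "wins \<mu> \<nu> = (\<Sum>i\<in>D. of_bool ((\<mu> i, \<nu> i) \<in> P i))"
proof -
  have "{x \<in> N. (\<mu> x, \<nu> x) \<in> P x} = {x \<in> D. (\<mu> x, \<nu> x) \<in> P x}"
    using assms by (auto simp: Ball_def) (metis DiffI pref_irrefl)
  moreover have "finite D"
    using assms(1) finite_agents finite_subset by blast
  ultimately show ?thesis
    by (simp add: wins_def sum_of_bool_eq Int_def conj_commute)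
qed

lemma coset_subset: "coset \<mu> T \<subseteq> M"
  by (auto simp: coset_def)

text \<open>The order of the list is that of the six summands in \<open>four_agents\<close>, so that
  counting over a coset yields exactly its hypotheses.\<close>

lemma coset_eq:
  assumes "\<mu> \<in> M" "y \<in> N" "z \<in> N" "w \<in> N" "distinct [y, z, w]"
  shows "coset \<mu> {y, z, w} = set [\<mu>, \<mu>(y := \<mu> y, z := \<mu> w, w := \<mu> z),
    \<mu>(y := \<mu> z, z := \<mu> y, w := \<mu> w), \<mu>(y := \<mu> z, z := \<mu> w, w := \<mu> y),
    \<mu>(y := \<mu> w, z := \<mu> y, w := \<mu> z), \<mu>(y := \<mu> w, z := \<mu> z, w := \<mu> y)]" (is "_ = ?R")
proof -
  have ne: "y \<noteq> z" "y \<noteq> w" "z \<noteq> w"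
    using assms(5) by auto
  note ne = ne ne[symmetric]
  show ?thesis
  proof (rule set_eqI, rule iffI)
    fix \<nu> assume \<nu>: "\<nu> \<in> ?R"
    have upd: "\<mu>(y := a, z := b, w := c) \<in> coset \<mu> {y, z, w}"
      if "{a, b, c} = {\<mu> y, \<mu> z, \<mu> w}" for a b c
    proof -
      have "(\<mu>(y := a, z := b, w := c)) ` {y, z, w} = {a, b, c}"
        using ne by simp
      then have "\<mu>(y := a, z := b, w := c) \<in> M"
        using assms(2-4) that by (intro reassign[OF assms(1), of "{y, z, w}"]) simp_all
      then show ?thesis
        by (simp add: coset_def)
    qed
    show "\<nu> \<in> coset \<mu> {y, z, w}"
      using \<nu> upd[of "\<mu> y" "\<mu> z" "\<mu> w"] upd[of "\<mu> y" "\<mu> w" "\<mu> z"]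
        upd[of "\<mu> z" "\<mu> y" "\<mu> w"] upd[of "\<mu> z" "\<mu> w" "\<mu> y"]
        upd[of "\<mu> w" "\<mu> y" "\<mu> z"] upd[of "\<mu> w" "\<mu> z" "\<mu> y"]
      by (simp only: list.set fun_upd_triv insert_commute insert_iff empty_iff) blast
  next
    fix \<nu> assume "\<nu> \<in> coset \<mu> {y, z, w}"
    then have \<nu>: "\<nu> \<in> M" "\<And>i. i \<notin> {y, z, w} \<Longrightarrow> \<nu> i = \<mu> i"
      by (auto simp: coset_def)
    have mem: "\<nu> t \<in> {\<mu> y, \<mu> z, \<mu> w}" if "t \<in> {y, z, w}" for t
    proof -
      have "t \<in> N"
        using that assms by auto
      then obtain s where s: "s \<in> N" "\<nu> t = \<mu> s"
        using assignment_image \<nu>(1) assms(1) by (metis image_iff)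
      then show ?thesis
        using \<nu> assignment_eq_iff[OF \<nu>(1) \<open>t \<in> N\<close> s(1)] that by (cases "s \<in> {y, z, w}") auto
    qed
    have eq: "\<nu> = \<mu>(y := \<nu> y, z := \<nu> z, w := \<nu> w)"
      using \<nu>(2) by auto
    have "\<nu> y \<noteq> \<nu> z" "\<nu> y \<noteq> \<nu> w" "\<nu> z \<noteq> \<nu> w"
      using assms(2-5) assignment_eq_iff[OF \<nu>(1)] by auto
    then have "(\<nu> y, \<nu> z, \<nu> w) \<in> {(\<mu> y, \<mu> z, \<mu> w), (\<mu> y, \<mu> w, \<mu> z), (\<mu> z, \<mu> y, \<mu> w),
        (\<mu> z, \<mu> w, \<mu> y), (\<mu> w, \<mu> y, \<mu> z), (\<mu> w, \<mu> z, \<mu> y)}"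
      using mem[of y] mem[of z] mem[of w] by (simp; metis)
    then show "\<nu> \<in> ?R"
      by (subst eq) auto
  qed
qed

lemma coset_distinct:
  assumes "\<mu> \<in> M" "y \<in> N" "z \<in> N" "w \<in> N" "distinct [y, z, w]"
  shows "distinct [\<mu>, \<mu>(y := \<mu> y, z := \<mu> w, w := \<mu> z),
    \<mu>(y := \<mu> z, z := \<mu> y, w := \<mu> w), \<mu>(y := \<mu> z, z := \<mu> w, w := \<mu> y),
    \<mu>(y := \<mu> w, z := \<mu> y, w := \<mu> z), \<mu>(y := \<mu> w, z := \<mu> z, w := \<mu> y)]"
  using assms by (auto simp: fun_eq_iff assignment_eq_iff)

lemma card_coset:
  assumes "\<mu> \<in> M" "y \<in> N" "z \<in> N" "w \<in> N" "distinct [y, z, w]"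
  shows "card (coset \<mu> {y, z, w}) = 6"
  unfolding coset_eq[OF assms] using distinct_card[OF coset_distinct[OF assms]] by simp

lemma card_coset_Int:
  assumes "\<mu> \<in> M" "y \<in> N" "z \<in> N" "w \<in> N" "distinct [y, z, w]"
  shows "card (coset \<mu> {y, z, w} \<inter> X) =
    of_bool (\<mu> \<in> X) + of_bool (\<mu>(y := \<mu> y, z := \<mu> w, w := \<mu> z) \<in> X)
    + of_bool (\<mu>(y := \<mu> z, z := \<mu> y, w := \<mu> w) \<in> X)
    + of_bool (\<mu>(y := \<mu> z, z := \<mu> w, w := \<mu> y) \<in> X)
    + of_bool (\<mu>(y := \<mu> w, z := \<mu> y, w := \<mu> z) \<in> X)
    + of_bool (\<mu>(y := \<mu> w, z := \<mu> z, w := \<mu> y) \<in> X)"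
proof -
  have sum_set: "card (set xs \<inter> X) = sum_list (map (\<lambda>\<nu>. of_bool (\<nu> \<in> X)) xs)" if "distinct xs" for xs
    using that by (induction xs) auto
  show ?thesis
    unfolding coset_eq[OF assms] sum_set[OF coset_distinct[OF assms]] by simp
qed

end

section \<open>Sets that strictly beat their complement\<close>

text \<open>This is the only property of the top cycle used in the structural argument. Stated for
  an arbitrary \<open>A\<close>, it also applies to reversed preferences and to explicitly
  constructed sets.\<close>

locale separation = preference_profile n H P
  for n :: nat and H :: "'h set" and P :: "nat \<Rightarrow> ('h \<times> 'h) set" +
  fixes A :: "(nat \<Rightarrow> 'h) set"
  assumes A_subset: "A \<subseteq> M"
    and A_wins: "\<lbrakk>\<mu> \<in> A; \<nu> \<in> M - A\<rbrakk> \<Longrightarrow> wins \<nu> \<mu> < wins \<mu> \<nu>"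
begin

text \<open>Everything outside the four agents is fixed, so \<open>four_agents\<close> applies to
  their houses. Agent \<open>x\<close> keeps her house throughout the first coset and holds that of
  \<open>y\<close> throughout the second, which gives the leading \<open>a\<close> and
  \<open>b\<close> there.\<close>

lemma no_mixed_cosets:
  assumes \<mu>: "\<mu> \<in> M" and N: "x \<in> N" "y \<in> N" "z \<in> N" "w \<in> N" and dist: "distinct [x, y, z, w]"
    and A: "3 \<le> card (coset \<mu> {y, z, w} \<inter> A)"
    and B: "3 \<le> card (coset (swap x y \<mu>) {y, z, w} \<inter> - A)"
  shows False
proof (rule four_agents[of "\<mu> x" "\<mu> y" "\<mu> z" "\<mu> w" "\<lambda>g h. (g, h) \<in> P x" "\<lambda>g h. (g, h) \<in> P y"
      "\<lambda>g h. (g, h) \<in> P z" "\<lambda>g h. (g, h) \<in> P w" "\<lambda>g h k l. \<mu>(x := g, y := h, z := k, w := l) \<in> A"])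
  have inH: "{\<mu> x, \<mu> y, \<mu> z, \<mu> w} \<subseteq> H"
    using \<mu> N by simp
  have ne: "x \<noteq> y" "x \<noteq> z" "x \<noteq> w" "y \<noteq> z" "y \<noteq> w" "z \<noteq> w"
    using dist by auto
  note ne' = ne ne[symmetric]
  show "distinct [\<mu> x, \<mu> y, \<mu> z, \<mu> w]"
    using \<mu> N dist by (simp add: assignment_eq_iff)
  show "(\<not> (g, h) \<in> P x) = ((h, g) \<in> P x) \<and> (\<not> (g, h) \<in> P y) = ((h, g) \<in> P y) \<and>
      (\<not> (g, h) \<in> P z) = ((h, g) \<in> P z) \<and> (\<not> (g, h) \<in> P w) = ((h, g) \<in> P w)"
    if "g \<in> {\<mu> x, \<mu> y, \<mu> z, \<mu> w}" "h \<in> {\<mu> x, \<mu> y, \<mu> z, \<mu> w}" "g \<noteq> h" for g h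
    using not_pref_iff N inH that by (meson subsetD)
  show "(of_bool ((g', g) \<in> P x) + of_bool ((h', h) \<in> P y) + of_bool ((k', k) \<in> P z) + of_bool ((l', l) \<in> P w) :: nat)
      < of_bool ((g, g') \<in> P x) + of_bool ((h, h') \<in> P y) + of_bool ((k, k') \<in> P z) + of_bool ((l, l') \<in> P w)"
    if "distinct [g, h, k, l]" "{g, h, k, l} = {\<mu> x, \<mu> y, \<mu> z, \<mu> w}"
      "distinct [g', h', k', l']" and set': "{g', h', k', l'} = {\<mu> x, \<mu> y, \<mu> z, \<mu> w}"
      and "\<mu>(x := g, y := h, z := k, w := l) \<in> A" "\<mu>(x := g', y := h', z := k', w := l') \<notin> A"
    for g h k l g' h' k' l'
  proof -
    let ?\<alpha> = "\<mu>(x := g, y := h, z := k, w := l)" and ?\<beta> = "\<mu>(x := g', y := h', z := k', w := l')"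
    have "?\<beta> ` {x, y, z, w} = {g', h', k', l'}"
      by (simp add: ne')
    also have "\<dots> = \<mu> ` {x, y, z, w}"
      using set' by simp
    finally have "?\<beta> \<in> M"
      using N by (intro reassign[OF \<mu>, of "{x, y, z, w}"]) auto
    then have "wins ?\<beta> ?\<alpha> < wins ?\<alpha> ?\<beta>"
      using A_wins that by blast
    moreover have "wins ?\<beta> ?\<alpha> = (\<Sum>i\<in>{x, y, z, w}. of_bool ((?\<beta> i, ?\<alpha> i) \<in> P i))"
      "wins ?\<alpha> ?\<beta> = (\<Sum>i\<in>{x, y, z, w}. of_bool ((?\<alpha> i, ?\<beta> i) \<in> P i))"
      using N by (intro wins_eq_sum; auto)+
    ultimately show ?thesis
      by (simp add: ne' add.assoc del: sum_of_bool_eq)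
  qed
  show "3 \<le> (of_bool (\<mu>(x := \<mu> x, y := \<mu> y, z := \<mu> z, w := \<mu> w) \<in> A)
    + of_bool (\<mu>(x := \<mu> x, y := \<mu> y, z := \<mu> w, w := \<mu> z) \<in> A)
    + of_bool (\<mu>(x := \<mu> x, y := \<mu> z, z := \<mu> y, w := \<mu> w) \<in> A)
    + of_bool (\<mu>(x := \<mu> x, y := \<mu> z, z := \<mu> w, w := \<mu> y) \<in> A)
    + of_bool (\<mu>(x := \<mu> x, y := \<mu> w, z := \<mu> y, w := \<mu> z) \<in> A)
    + of_bool (\<mu>(x := \<mu> x, y := \<mu> w, z := \<mu> z, w := \<mu> y) \<in> A) :: nat)"
    using A N dist by (simp add: card_coset_Int \<mu>)
  have swap_upd: "(swap x y \<mu>)(y := h, z := k, w := l) = \<mu>(x := \<mu> y, y := h, z := k, w := l)" for h k l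
    by (auto simp: swap_def fun_eq_iff ne')
  have "swap x y \<mu> = \<mu>(x := \<mu> y, y := \<mu> x, z := \<mu> z, w := \<mu> w)"
    by (auto simp: swap_def fun_eq_iff ne')
  note swap_id = this[symmetric]
  have "distinct [y, z, w]"
    using dist by simp
  note card_swap = card_coset_Int[OF swap_assignment[OF \<mu> N(1,2)] N(2-4) this, of "- A"]
  show "3 \<le> (of_bool (\<mu>(x := \<mu> y, y := \<mu> x, z := \<mu> z, w := \<mu> w) \<notin> A)
    + of_bool (\<mu>(x := \<mu> y, y := \<mu> x, z := \<mu> w, w := \<mu> z) \<notin> A)
    + of_bool (\<mu>(x := \<mu> y, y := \<mu> z, z := \<mu> x, w := \<mu> w) \<notin> A)
    + of_bool (\<mu>(x := \<mu> y, y := \<mu> z, z := \<mu> w, w := \<mu> x) \<notin> A)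
    + of_bool (\<mu>(x := \<mu> y, y := \<mu> w, z := \<mu> x, w := \<mu> z) \<notin> A)
    + of_bool (\<mu>(x := \<mu> y, y := \<mu> w, z := \<mu> z, w := \<mu> x) \<notin> A) :: nat)"
    using B unfolding card_swap swap_upd swap_id by (simp add: ne' del: of_bool_not_iff)
qed

end

section \<open>Connectivity by swaps and double counting\<close>

context preference_profile
begin

text \<open>Swaps connect \<open>M\<close>: a misplaced agent \<open>i\<close> takes her house under
  \<nu> from its holder \<open>j\<close>, who was misplaced too, and the number of disagreements
  drops.\<close>

lemma swap_induct [consumes 2, case_names base swap]:
  assumes "\<mu> \<in> M" "\<nu> \<in> M" and base: "Q \<mu>"
    and swap: "\<And>\<mu> x y. \<lbrakk>\<mu> \<in> M; x \<in> N; y \<in> N; Q \<mu>\<rbrakk> \<Longrightarrow> Q (swap x y \<mu>)"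
  shows "Q \<nu>"
  using assms(1) base
proof (induction "card {i \<in> N. \<mu> i \<noteq> \<nu> i}" arbitrary: \<mu> rule: less_induct)
  case less
  show ?case
  proof (cases "\<exists>i\<in>N. \<mu> i \<noteq> \<nu> i")
    case True
    then obtain i where i: "i \<in> N" "\<mu> i \<noteq> \<nu> i"
      by blast
    obtain j where j: "j \<in> N" "\<mu> j = \<nu> i"
      using assignment_image[OF less.prems(1)] assignment_in_houses[OF assms(2) i(1)] by (metis imageE)
    have "\<nu> j \<noteq> \<mu> j"
      using i j assignment_eq_iff[OF assms(2) i(1) j(1)] by auto
    then have "{k \<in> N. swap i j \<mu> k \<noteq> \<nu> k} \<subset> {k \<in> N. \<mu> k \<noteq> \<nu> k}"
      using i j by (auto simp: swap_def)
    then have "card {k \<in> N. swap i j \<mu> k \<noteq> \<nu> k} < card {k \<in> N. \<mu> k \<noteq> \<nu> k}"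
      by (intro psubset_card_mono) auto
    then show ?thesis
      using less i j swap by simp
  next
    case False
    then show ?thesis
      using less.prems assignment_eqI[OF less.prems(1) assms(2)] by auto
  qed
qed

lemma card_coset_triple:
  assumes "\<mu> \<in> M" "T \<subseteq> N" "card T = 3"
  shows "card (coset \<mu> T) = 6"
proof -
  obtain y z w where "T = {y, z, w}" "y \<noteq> z" "z \<noteq> w" "y \<noteq> w"
    using assms(3) by (auto simp: card_3_iff)
  then show ?thesis
    using assms(1,2) card_coset[of \<mu> y z w] by simp
qed

lemma finite_coset [simp]: "finite (coset \<mu> T)"
  using coset_subset finite_assignments finite_subset by blast

lemma coset_split:
  assumes "\<mu> \<in> M" "T \<subseteq> N" "card T = 3"
  shows "card (coset \<mu> T \<inter> X) + card (coset \<mu> T \<inter> - X) = 6"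
  using card_Un_disjoint[of "coset \<mu> T \<inter> X" "coset \<mu> T \<inter> - X"] card_coset_triple[OF assms]
  by (simp add: Int_Un_distrib[symmetric] Int_assoc disjoint_iff)

lemma coset_sym: "\<lbrakk>\<mu> \<in> M; \<nu> \<in> M\<rbrakk> \<Longrightarrow> \<nu> \<in> coset \<mu> T \<longleftrightarrow> \<mu> \<in> coset \<nu> T"
  by (auto simp: coset_def)

lemma coset_swap_eq: "\<lbrakk>s \<in> T; t \<in> T\<rbrakk> \<Longrightarrow> coset (swap s t \<mu>) T = coset \<mu> T"
  by (auto simp: coset_def swap_def)

text \<open>Pairs of an assignment and a member of \<open>X\<close> in the same coset are counted
  twice: each member of \<open>X\<close> lies in six pairs, each assignment in at most two.\<close>

lemma card_bound_of_coset_bound: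
  assumes "X \<subseteq> M" "T \<subseteq> N" "card T = 3" and small: "\<And>\<mu>. \<mu> \<in> M \<Longrightarrow> card (coset \<mu> T \<inter> X) \<le> 2"
  shows "3 * card X \<le> card M"
proof -
  have fin: "finite X"
    using assms(1) finite_assignments finite_subset by blast
  have "6 * card X = (\<Sum>\<nu>\<in>X. card (coset \<nu> T))"
    using card_coset_triple assms(1-3) by (simp add: subset_iff)
  also have "\<dots> = (\<Sum>\<nu>\<in>X. \<Sum>\<mu>\<in>M. of_bool (\<mu> \<in> coset \<nu> T))"
    using coset_subset by (intro sum.cong) (auto simp: sum_of_bool_eq finite_assignments Int_absorb1)
  also have "\<dots> = (\<Sum>\<mu>\<in>M. \<Sum>\<nu>\<in>X. of_bool (\<mu> \<in> coset \<nu> T))"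
    by (rule sum.swap)
  also have "\<dots> = (\<Sum>\<mu>\<in>M. card (coset \<mu> T \<inter> X))"
  proof (intro sum.cong refl)
    fix \<mu> assume "\<mu> \<in> M"
    then have "X \<inter> {\<nu>. \<mu> \<in> coset \<nu> T} = coset \<mu> T \<inter> X"
      using assms(1) coset_sym by auto
    then show "(\<Sum>\<nu>\<in>X. of_bool (\<mu> \<in> coset \<nu> T)) = card (coset \<mu> T \<inter> X)"
      using fin by (simp add: sum_of_bool_eq)
  qed
  also have "\<dots> \<le> (\<Sum>\<mu>\<in>M. 2)"
    using small by (rule sum_mono)
  finally show ?thesis
    by simp
qed

lemma assignments_nonempty: "M \<noteq> {}"
proof -
  obtain f where f: "bij_betw f N H"
    using finite_same_card_bij[of N H] by (auto simp: card_agents card_houses)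
  then have "(\<lambda>x. if x \<in> N then f x else undefined) \<in> M"
    by (auto simp: assignments_def cong: bij_betw_cong)
  then show ?thesis
    by blast
qed

end

section \<open>Dichotomy between few losers and few winners\<close>

context separation
begin

text \<open>Heavy means having at least three winners; \<open>no_mixed_cosets\<close> applies with
  \<open>T\<close> written as \<open>{t, z, w}\<close>.\<close>

lemma heavy_swap_outside:
  assumes "\<mu> \<in> M" "T \<subseteq> N" "card T = 3" "x \<in> N - T" "t \<in> T" and heavy: "3 \<le> card (coset \<mu> T \<inter> A)"
  shows "card (coset (swap x t \<mu>) T \<inter> - A) \<le> 2"
proof (rule ccontr)
  assume "\<not> card (coset (swap x t \<mu>) T \<inter> - A) \<le> 2"
  moreover have "finite T"
    using assms(3) card.infinite by force
  then obtain z w where "T - {t} = {z, w}" "z \<noteq> w"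
    using assms(3,5) card_2_iff[of "T - {t}"] by auto
  then have "T = {t, z, w}" "distinct [t, z, w]"
    using assms(5) by auto
  ultimately show False
    using no_mixed_cosets[of \<mu> x t z w] assms by auto
qed

text \<open>Swaps inside \<open>T\<close> preserve the coset. Swaps across its boundary leave at
  most two losers among six, hence at least four winners. Swaps outside \<open>T\<close> are
  composed of swaps across.\<close>

lemma heavy_swap:
  assumes "\<mu> \<in> M" "T \<subseteq> N" "card T = 3" "x \<in> N" "y \<in> N" "3 \<le> card (coset \<mu> T \<inter> A)"
  shows "3 \<le> card (coset (swap x y \<mu>) T \<inter> A)"
proof -
  have out: "3 \<le> card (coset (swap x t \<mu>) T \<inter> A)"
    if "\<mu> \<in> M" "x \<in> N - T" "t \<in> T" "3 \<le> card (coset \<mu> T \<inter> A)" for \<mu> x t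
  proof -
    have "swap x t \<mu> \<in> M"
      using that assms(2) by auto
    then show ?thesis
      using heavy_swap_outside[OF that(1) assms(2,3) that(2-4)] coset_split[of "swap x t \<mu>" T A] assms(2,3)
      by linarith
  qed
  show ?thesis
  proof (cases "x \<in> T"; cases "y \<in> T")
    assume "x \<in> T" "y \<in> T"
    then show ?thesis
      using assms coset_swap_eq by simp
  next
    assume "x \<in> T" "y \<notin> T"
    then show ?thesis
      using out[of \<mu> y x] assms by (simp add: swap_commute)
  next
    assume "x \<notin> T" "y \<in> T"
    then show ?thesis
      using out[of \<mu> x y] assms by simp
  next
    assume xy: "x \<notin> T" "y \<notin> T"
    obtain t where t: "t \<in> T"
      using assms(3) by fastforce
    show ?thesis
    proof (cases "x = y")
      case True
      then show ?thesis
        using assms by (simp add: swap_def)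
    next
      case False
      \<comment> \<open>A transposition outside \<open>T\<close> is a conjugate of one across the
        boundary, using an auxiliary \<open>t\<close> in \<open>T\<close>.\<close>
      have "swap x y \<mu> = swap x t (swap y t (swap x t \<mu>))"
        using xy t False by (auto simp: swap_def fun_eq_iff)
      then show ?thesis
        using out[of \<mu> x t] out[of "swap x t \<mu>" y t] out[of "swap y t (swap x t \<mu>)" x t] assms xy t
        by auto
    qed
  qed
qed

text \<open>One heavy coset makes all cosets heavy, since swaps connect \<open>M\<close>; a swap
  across the boundary then sharpens this to at most two losers. The bound on \<open>n\<close>
  supplies an agent outside \<open>T\<close>.\<close>

lemma coset_dichotomy:
  assumes "4 \<le> n" "T \<subseteq> N" "card T = 3"
  shows "(\<forall>\<mu>\<in>M. card (coset \<mu> T \<inter> - A) \<le> 2) \<or> (\<forall>\<mu>\<in>M. card (coset \<mu> T \<inter> A) \<le> 2)"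
proof (cases "\<exists>\<mu>\<in>M. 3 \<le> card (coset \<mu> T \<inter> A)")
  case True
  then obtain \<mu> where \<mu>: "\<mu> \<in> M" "3 \<le> card (coset \<mu> T \<inter> A)"
    by blast
  have "\<not> N \<subseteq> T"
    using assms card_agents card_mono[of T N] by (metis card.infinite not_numeral_le_zero numeral_le_iff
      le_trans semiring_norm(69) semiring_norm(72) zero_neq_numeral)
  then obtain x where x: "x \<in> N - T"
    by blast
  obtain t where t: "t \<in> T"
    using assms(3) by fastforce
  have "card (coset \<nu> T \<inter> - A) \<le> 2" if \<nu>: "\<nu> \<in> M" for \<nu>
  proof -
    \<comment> \<open>The bound for \<nu> comes from its neighbour \<open>swap x t \<nu>\<close>,
      because swapping again returns to \<nu>.\<close>
    have sw: "swap x t \<nu> \<in> M"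
      using \<nu> x t assms(2) by auto
    have "3 \<le> card (coset (swap x t \<nu>) T \<inter> A)"
      by (rule swap_induct[OF \<mu>(1) sw, where Q = "\<lambda>\<mu>. 3 \<le> card (coset \<mu> T \<inter> A)"])
        (use \<mu> heavy_swap assms in auto)
    then show ?thesis
      using heavy_swap_outside[OF sw assms(2,3) x t] by simp
  qed
  then show ?thesis
    by blast
qed (simp add: not_le; force)

text \<open>If two triples fell under different alternatives, \<open>A\<close> and its complement
  would each contain at most a third of \<open>M\<close>.\<close>

lemma small_cosets_cases:
  assumes "4 \<le> n"
  shows "(\<forall>T \<mu>. T \<subseteq> N \<longrightarrow> card T = 3 \<longrightarrow> \<mu> \<in> M \<longrightarrow> card (coset \<mu> T \<inter> (M - A)) \<le> 2) \<or>
    (\<forall>T \<mu>. T \<subseteq> N \<longrightarrow> card T = 3 \<longrightarrow> \<mu> \<in> M \<longrightarrow> card (coset \<mu> T \<inter> A) \<le> 2)"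
proof (rule ccontr)
  have B: "coset \<mu> T \<inter> (M - A) = coset \<mu> T \<inter> - A" for \<mu> T
    using coset_subset by blast
  assume "\<not> ?thesis"
  then obtain T T' where T: "T \<subseteq> N" "card T = 3" "\<not> (\<forall>\<mu>\<in>M. card (coset \<mu> T \<inter> - A) \<le> 2)"
    and T': "T' \<subseteq> N" "card T' = 3" "\<not> (\<forall>\<mu>\<in>M. card (coset \<mu> T' \<inter> A) \<le> 2)"
    unfolding B by blast
  have "3 * card A \<le> card M"
    using coset_dichotomy[OF assms T(1,2)] T card_bound_of_coset_bound[OF A_subset T(1,2)] by blast
  moreover have "3 * card (M - A) \<le> card M"
    using coset_dichotomy[OF assms T'(1,2)] T' card_bound_of_coset_bound[of "M - A" T', unfolded B]
    by blast
  moreover have "card (M - A) = card M - card A" "card A \<le> card M"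
    using A_subset finite_assignments by (auto intro: card_Diff_subset card_mono finite_subset)
  moreover have "card M > 0"
    using assignments_nonempty finite_assignments by (simp add: card_gt_0_iff)
  ultimately show False
    by linarith
qed

end

section \<open>Last and second-to-last houses\<close>

context preference_profile
begin

lemma ex_bottom:
  assumes "x \<in> N" "S \<subseteq> H" "S \<noteq> {}"
  shows "\<exists>t\<in>S. \<forall>h\<in>S. h \<noteq> t \<longrightarrow> (h, t) \<in> P x"
proof -
  have "finite S"
    using assms(2) finite_houses finite_subset by blast
  then show ?thesis
    using assms(3,2)
  proof (induction rule: finite_ne_induct)
    case (singleton s)
    then show ?case
      by simp
  next
    case (insert s S)
    then obtain t where t: "t \<in> S" "\<forall>h\<in>S. h \<noteq> t \<longrightarrow> (h, t) \<in> P x"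
      by auto
    show ?case
    proof (cases "(s, t) \<in> P x")
      case True
      then show ?thesis
        using t by (intro bexI[of _ t]) simp_all
    next
      case False
      moreover have "s \<noteq> t" "s \<in> H" "t \<in> H"
        using insert t(1) by auto
      ultimately have ts: "(t, s) \<in> P x"
        using not_pref_iff[OF assms(1), of s t] by simp
      have "(h, s) \<in> P x" if "h \<in> S" for h
        using t(2) that ts pref_trans[OF assms(1), of h t s] by (cases "h = t") simp_all
      then show ?thesis
        by (intro bexI[of _ s]) simp_all
    qed
  qed
qed

text \<open>Existence and uniqueness of a last house in a nonempty set give the definite description
  its intended meaning.\<close>

lemma bot_of_eq_iff:
  assumes "x \<in> N" "S \<subseteq> H" "S \<noteq> {}"
  shows "bot_of (P x) S = t \<longleftrightarrow> t \<in> S \<and> (\<forall>h\<in>S. h \<noteq> t \<longrightarrow> (h, t) \<in> P x)"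
proof -
  obtain s where s: "s \<in> S" "\<forall>h\<in>S. h \<noteq> s \<longrightarrow> (h, s) \<in> P x"
    using ex_bottom[OF assms] by blast
  have uniq: "u = s" if "u \<in> S \<and> (\<forall>h\<in>S. h \<noteq> u \<longrightarrow> (h, u) \<in> P x)" for u
    using that s pref_asym[OF assms(1), of u s] by metis
  have eq: "bot_of (P x) S = s"
    unfolding bot_of_def
  proof (rule the_equality)
    show "s \<in> S \<and> (\<forall>h\<in>S. h \<noteq> s \<longrightarrow> (h, s) \<in> P x)"
      using s by (rule conjI)
  qed (rule uniq)
  show ?thesis
  proof
    assume "bot_of (P x) S = t"
    then show "t \<in> S \<and> (\<forall>h\<in>S. h \<noteq> t \<longrightarrow> (h, t) \<in> P x)"
      unfolding eq using s by (elim subst) (rule conjI)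
  next
    assume "t \<in> S \<and> (\<forall>h\<in>S. h \<noteq> t \<longrightarrow> (h, t) \<in> P x)"
    from uniq[OF this] show "bot_of (P x) S = t"
      using eq by (rule trans[OF _ sym, rotated])
  qed
qed

definition worst :: "nat \<Rightarrow> 'h" where "worst = bottom_choice H P"
definition second_worst :: "nat \<Rightarrow> 'h" where "second_worst = second_last_choice H P"

lemma
  assumes "x \<in> N"
  shows worst_in_houses: "worst x \<in> H"
    and pref_worst: "\<lbrakk>h \<in> H; h \<noteq> worst x\<rbrakk> \<Longrightarrow> (h, worst x) \<in> P x"
proof -
  have "H \<noteq> {}"
    using assms card_houses by (auto simp: agents_def)
  then show "worst x \<in> H" "\<lbrakk>h \<in> H; h \<noteq> worst x\<rbrakk> \<Longrightarrow> (h, worst x) \<in> P x"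
    using bot_of_eq_iff[OF assms subset_refl] by (auto simp: worst_def bottom_choice_def)
qed

lemma
  assumes "2 \<le> n" "x \<in> N"
  shows second_worst_in_houses: "second_worst x \<in> H" and second_worst_neq_worst: "second_worst x \<noteq> worst x"
    and pref_second_worst: "\<lbrakk>h \<in> H; h \<noteq> worst x; h \<noteq> second_worst x\<rbrakk> \<Longrightarrow> (h, second_worst x) \<in> P x"
proof -
  have "card (H - {worst x}) \<noteq> 0"
    using assms worst_in_houses by (simp add: card_houses)
  then have ne: "H - {worst x} \<noteq> {}"
    by (metis card.empty)
  show "second_worst x \<in> H" "second_worst x \<noteq> worst x" "\<lbrakk>h \<in> H; h \<noteq> worst x; h \<noteq> second_worst x\<rbrakk> \<Longrightarrow> (h, second_worst x) \<in> P x"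
    using bot_of_eq_iff[OF assms(2) Diff_subset ne] worst_in_houses[OF assms(2)]
    by (auto simp: second_worst_def worst_def second_last_choice_def)
qed

lemma obtain_holder:
  assumes "\<mu> \<in> M" "h \<in> H"
  obtains y where "y \<in> N" "\<mu> y = h"
  using assms assignment_image[of \<mu>] by blast

end

section \<open>Structure of the losing assignments\<close>

text \<open>One alternative of \<open>small_cosets_cases\<close>. The bound \<open>five\<close>
  leaves three agents beside any two, as \<open>no_double_loss\<close> requires.\<close>

locale few_losers = separation n H P A
  for n :: nat and H :: "'h set" and P :: "nat \<Rightarrow> ('h \<times> 'h) set" and A :: "(nat \<Rightarrow> 'h) set" +
  assumes five: "5 \<le> n"
    and few: "\<lbrakk>T \<subseteq> N; card T = 3; \<mu> \<in> M\<rbrakk> \<Longrightarrow> card (coset \<mu> T \<inter> (M - A)) \<le> 2"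
begin

abbreviation "B \<equiv> M - A"

lemma two: "2 \<le> n"
  using five by simp

text \<open>If \<nu> were a winner, it would beat \<mu> strictly.\<close>

lemma losers_closed: "\<lbrakk>\<mu> \<in> B; \<nu> \<in> M; wins \<nu> \<mu> \<le> wins \<mu> \<nu>\<rbrakk> \<Longrightarrow> \<nu> \<in> B"
  using A_wins[of \<nu> \<mu>] by auto

text \<open>Otherwise \<mu> and its two swaps are three losers in the coset of
  \<open>{x, y, z}\<close>.\<close>

lemma matching:
  assumes "\<mu> \<in> B" "swap x y \<mu> \<in> B" "swap x z \<mu> \<in> B" "x \<in> N" "y \<in> N" "z \<in> N" "x \<noteq> y" "x \<noteq> z"
  shows "y = z"
proof (rule ccontr)
  assume "y \<noteq> z"
  have ne: "\<mu> x \<noteq> \<mu> y" "\<mu> x \<noteq> \<mu> z" "\<mu> y \<noteq> \<mu> z"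
    using assms \<open>y \<noteq> z\<close> by (simp_all add: assignment_eq_iff)
  have "\<mu> \<noteq> swap x y \<mu>" "\<mu> \<noteq> swap x z \<mu>" "swap x y \<mu> \<noteq> swap x z \<mu>"
    using ne by (metis swap_simps(1))+
  then have "card {\<mu>, swap x y \<mu>, swap x z \<mu>} = 3"
    by simp
  moreover have "{\<mu>, swap x y \<mu>, swap x z \<mu>} \<subseteq> coset \<mu> {x, y, z} \<inter> B"
    using assms by (auto simp: coset_def)
  ultimately have "3 \<le> card (coset \<mu> {x, y, z} \<inter> B)"
    by (metis card_mono finite_Int finite_coset)
  moreover have "card {x, y, z} = 3"
    using assms \<open>y \<noteq> z\<close> by simp
  ultimately show False
    using few[of "{x, y, z}" \<mu>] assms by simp
qed

lemma losers_swap: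
  assumes "\<mu> \<in> B" "x \<in> N" "y \<in> N" "x \<noteq> y" "(\<mu> x, \<mu> y) \<in> P x"
  shows "swap x y \<mu> \<in> B"
proof (rule losers_closed[OF assms(1)])
  show "swap x y \<mu> \<in> M"
    using assms by simp
  have "wins (swap x y \<mu>) \<mu> = (\<Sum>i\<in>{x, y}. of_bool ((swap x y \<mu> i, \<mu> i) \<in> P i))"
    "wins \<mu> (swap x y \<mu>) = (\<Sum>i\<in>{x, y}. of_bool ((\<mu> i, swap x y \<mu> i) \<in> P i))"
    using assms by (intro wins_eq_sum; auto)+
  then show "wins (swap x y \<mu>) \<mu> \<le> wins \<mu> (swap x y \<mu>)"
    using assms pref_asym by (simp del: sum_of_bool_eq)
qed

text \<open>Were a losing assignment harmed twice by a swap of \<open>u\<close> and \<open>v\<close>, every further swap away from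
  \<open>u\<close>, \<open>v\<close> would still lose, and three more agents provide too many of those.\<close>

lemma no_double_loss:
  assumes \<mu>: "\<mu> \<in> B" and uv: "u \<in> N" "v \<in> N" "u \<noteq> v" "(\<mu> u, \<mu> v) \<in> P u" "(\<mu> v, \<mu> u) \<in> P v"
  shows False
proof -
  let ?\<nu> = "swap u v \<mu>"
  have \<nu>: "?\<nu> \<in> B"
    using losers_swap assms by blast
  \<comment> \<open>Both \<open>u\<close> and \<open>v\<close> vote for \<mu>, and only
    \<open>w\<close> and \<open>z\<close> can vote against it: at best a tie for the new
    assignment.\<close>
  have other: "swap w z ?\<nu> \<in> B" if wz: "w \<in> N - {u, v}" "z \<in> N - {u, v}" "w \<noteq> z" for w z
  proof (rule losers_closed[OF \<mu>])
    show M: "swap w z ?\<nu> \<in> M"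
      using \<nu> wz by simp
    have "wins (swap w z ?\<nu>) \<mu> = (\<Sum>i\<in>{u, v, w, z}. of_bool ((swap w z ?\<nu> i, \<mu> i) \<in> P i))"
      "wins \<mu> (swap w z ?\<nu>) = (\<Sum>i\<in>{u, v, w, z}. of_bool ((\<mu> i, swap w z ?\<nu> i) \<in> P i))"
      using wz uv by (intro wins_eq_sum; auto)+
    moreover have "u \<notin> {v, w, z}" "v \<notin> {w, z}" "w \<noteq> z"
      using wz uv by auto
    moreover have "(\<mu> v, \<mu> u) \<notin> P u" "(\<mu> u, \<mu> v) \<notin> P v"
      using uv pref_asym by blast+
    ultimately show "wins (swap w z ?\<nu>) \<mu> \<le> wins \<mu> (swap w z ?\<nu>)"
      using uv by (simp del: sum_of_bool_eq)
  qed
  have "3 \<le> card (N - {u, v})"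
    using five uv by (simp add: card_agents)
  then obtain S where "S \<subseteq> N - {u, v}" "card S = 3"
    by (metis obtain_subset_with_card_n)
  then obtain w z t where "{w, z, t} \<subseteq> N - {u, v}" "w \<noteq> z" "w \<noteq> t" "z \<noteq> t"
    by (auto simp: card_3_iff)
  then show False
    using matching[OF \<nu> other other, of w z t] by auto
qed

text \<open>If both of her last two houses were worse for \<open>x\<close>, swapping with either
  holder would hurt her and give a loser, against \<open>matching\<close>.\<close>

lemma last_two:
  assumes "\<mu> \<in> B" "x \<in> N" "\<mu> x \<noteq> worst x"
  shows "\<mu> x = second_worst x"
proof (rule ccontr)
  assume second_worst: "\<mu> x \<noteq> second_worst x"
  obtain y where y: "y \<in> N" "\<mu> y = worst x"
    using obtain_holder[of \<mu> "worst x"] assms worst_in_houses by auto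
  obtain z where z: "z \<in> N" "\<mu> z = second_worst x"
    using obtain_holder[of \<mu> "second_worst x"] assms second_worst_in_houses[OF two] by auto
  have "x \<noteq> y" "x \<noteq> z"
    using assms(3) second_worst y z by auto
  then have "swap x y \<mu> \<in> B" "swap x z \<mu> \<in> B"
    using assms y z second_worst by (intro losers_swap; simp add: pref_worst pref_second_worst[OF two])+
  then have "y = z"
    using matching assms y z \<open>x \<noteq> y\<close> \<open>x \<noteq> z\<close> by blast
  then show False
    using y z second_worst_neq_worst[OF two assms(2)] by simp
qed

text \<open>Otherwise \<open>y\<close> is hurt by a swap with the holder \<open>t\<close> of her own
  worst house, and \<open>x\<close> by a swap with \<open>y\<close>. Both swaps give losers, so
  \<open>matching\<close> at \<open>y\<close> yields \<open>t = x\<close>; then one swap hurts both,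
  against \<open>no_double_loss\<close>.\<close>

lemma partner:
  assumes \<mu>: "\<mu> \<in> B" and x: "x \<in> N" "\<mu> x \<noteq> worst x" and y: "y \<in> N" "\<mu> y = worst x"
  shows "worst y = worst x"
proof (rule ccontr)
  assume ne: "worst y \<noteq> worst x"
  have xy: "x \<noteq> y" "(\<mu> x, \<mu> y) \<in> P x"
    using \<mu> x y by (auto simp: pref_worst)
  obtain t where t: "t \<in> N" "\<mu> t = worst y"
    using obtain_holder[of \<mu> "worst y"] \<mu> y worst_in_houses by auto
  have yt: "y \<noteq> t" "(\<mu> y, \<mu> t) \<in> P y"
    using \<mu> y t ne by (auto simp: pref_worst worst_in_houses x)
  have "t = x"
    using matching[of \<mu> y t x] losers_swap[OF \<mu> y(1) t(1) yt] losers_swap[OF \<mu> x(1) y(1) xy]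
      \<mu> x y t xy yt by (simp add: swap_commute)
  then show False
    using no_double_loss[OF \<mu> x(1) y(1) xy] yt by simp
qed

text \<open>With two such agents, a losing assignment would give \<open>x\<close> the house of
  \<open>z\<close>. By \<open>last_two\<close> the houses of both \<open>x\<close> and
  \<open>z\<close> would then be the second-to-last house of \<open>x\<close>.\<close>

lemma one_above_bottom:
  assumes \<mu>: "\<mu> \<in> B" and x: "x \<in> N" "\<mu> x \<noteq> worst x" and z: "z \<in> N" "\<mu> z \<noteq> worst z"
  shows "x = z"
proof (rule ccontr)
  assume xz: "x \<noteq> z"
  have \<mu>M: "\<mu> \<in> M"
    using \<mu> by simp
  obtain y where y: "y \<in> N" "\<mu> y = worst x"
    using obtain_holder[OF \<mu>M worst_in_houses[OF x(1)]] by blast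
  obtain w where w: "w \<in> N" "\<mu> w = worst z"
    using obtain_holder[OF \<mu>M worst_in_houses[OF z(1)]] by blast
  have boty: "worst y = worst x" and botw: "worst w = worst z"
    using partner \<mu> x y z w by blast+
  have px: "(\<mu> x, \<mu> y) \<in> P x" and pz: "(\<mu> z, \<mu> w) \<in> P z"
    using \<mu>M x y z w by (auto simp: pref_worst)
  have "y \<noteq> x" "y \<noteq> z" "w \<noteq> x" "w \<noteq> z"
    using x y z w boty botw by auto
  moreover have "y \<noteq> w"
  proof
    \<comment> \<open>A common holder would have two losing swaps, with \<open>x\<close> and with
      \<open>z\<close>.\<close>
    assume "y = w"
    then show False
      using matching[of \<mu> y x z] losers_swap[OF \<mu> x(1) y(1) _ px] losers_swap[OF \<mu> z(1) w(1) _ pz]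
        \<mu> x z y xz \<open>y \<noteq> x\<close> \<open>y \<noteq> z\<close> by (auto simp: swap_commute)
  qed
  ultimately have "x \<noteq> y" "x \<noteq> z" "x \<noteq> w" "y \<noteq> z" "y \<noteq> w" "z \<noteq> w"
    using xz by blast+
  note dist = this this[symmetric]
  \<comment> \<open>\<open>d\<close> loses by two harmful swaps in succession. Between
    \<open>c\<close> and \<open>d\<close>, \<open>y\<close> and \<open>w\<close> vote for
    \<open>d\<close>, being at their worst houses in \<open>c\<close>, and only \<open>x\<close> and
    \<open>z\<close> can vote for \<open>c\<close>; hence \<open>c\<close> loses as well.\<close>
  define c d where "c = swap x z \<mu>" and "d = swap z w (swap x y \<mu>)"
  have c: "c x = \<mu> z" "c y = \<mu> y" "c z = \<mu> x" "c w = \<mu> w"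
    and d: "d x = \<mu> y" "d y = \<mu> x" "d z = \<mu> w" "d w = \<mu> z"
    and cd: "\<And>i. i \<notin> {x, y, z, w} \<Longrightarrow> c i = d i"
    unfolding c_def d_def swap_def by (simp_all add: dist)
  have "swap x y \<mu> \<in> B"
    using losers_swap[OF \<mu> x(1) y(1) _ px] by (simp add: dist)
  then have dB: "d \<in> B"
    unfolding d_def using losers_swap[of "swap x y \<mu>" z w] z(1) w(1) pz by (simp add: dist)
  have "c \<in> B"
  proof (rule losers_closed[OF dB])
    show "c \<in> M"
      unfolding c_def using \<mu>M x(1) z(1) by (rule swap_assignment)
    have "wins c d = (\<Sum>i\<in>{x, y, z, w}. of_bool ((c i, d i) \<in> P i))"
      "wins d c = (\<Sum>i\<in>{x, y, z, w}. of_bool ((d i, c i) \<in> P i))"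
      using x y z w cd by (intro wins_eq_sum; auto)+
    moreover have "(\<mu> x, \<mu> y) \<in> P y" "(\<mu> z, \<mu> w) \<in> P w"
      using \<mu>M x y z w boty botw by (metis assignment_in_houses pref_worst)+
    moreover from this have "(\<mu> y, \<mu> x) \<notin> P y" "(\<mu> w, \<mu> z) \<notin> P w"
      using pref_asym y w by blast+
    ultimately show "wins c d \<le> wins d c"
      by (simp add: c d dist del: sum_of_bool_eq)
  qed
  moreover have "\<mu> z \<noteq> \<mu> y"
    using assignment_eq_iff[OF \<mu>M z(1) y(1)] by (simp add: dist)
  ultimately have "\<mu> z = second_worst x"
    using last_two[of c x] x(1) y(2) c(1) by simp
  moreover have "\<mu> x = second_worst x"
    using last_two \<mu> x by blast
  ultimately show False
    using assignment_eq_iff[OF \<mu>M x(1) z(1)] xz by simp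
qed

text \<open>In a loser, either all agents are at the bottom, or exactly one is above it. In the
  first case \<open>partner\<close> and the distinct worst houses exclude any other loser. In the
  second, the only freedom left is which of two agents with the same worst house receives
  it.\<close>

theorem losers_cases:
  assumes "B \<noteq> {}"
  shows "cond_iv n H P \<and> card B = 1 \<or> cond_iii n H P \<and> card B = 2"
proof (cases "\<exists>\<mu>\<in>B. \<forall>x\<in>N. \<mu> x = worst x")
  case True
  then obtain \<mu> where \<mu>: "\<mu> \<in> B" "\<And>x. x \<in> N \<Longrightarrow> \<mu> x = worst x"
    by blast
  have inj: "inj_on worst N"
    using assignment_inj[of \<mu>] \<mu> inj_on_cong[of N \<mu> worst] by simp
  have "\<nu> = \<mu>" if \<nu>: "\<nu> \<in> B" for \<nu>
  proof (rule assignment_eqI)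
    fix x assume x: "x \<in> N"
    obtain y where y: "y \<in> N" "\<nu> y = worst x"
      using obtain_holder[of \<nu> "worst x"] \<nu> x worst_in_houses by auto
    show "\<nu> x = \<mu> x"
      using partner[OF \<nu> x _ y] inj_onD[OF inj, of y x] x y \<mu> by fastforce
  qed (use \<nu> \<mu> in auto)
  then have "B = {\<mu>}"
    using \<mu>(1) by blast
  moreover have "cond_iv n H P"
    using inj by (simp add: cond_iv_def worst_def)
  ultimately show ?thesis
    by simp
next
  case False
  obtain \<mu> where \<mu>: "\<mu> \<in> B"
    using assms by blast
  then obtain x where x: "x \<in> N" "\<mu> x \<noteq> worst x"
    using False by blast
  have \<mu>M: "\<mu> \<in> M"
    using \<mu> by simp
  obtain y where y: "y \<in> N" "\<mu> y = worst x"
    using obtain_holder[OF \<mu>M worst_in_houses[OF x(1)]] by blast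
  have xy: "x \<noteq> y" and bots: "worst y = worst x"
    using x y partner[OF \<mu> x y] by auto
  have rest: "\<mu> z = worst z" if "z \<in> N" "z \<noteq> x" for z
    using one_above_bottom[OF \<mu> x] that by blast
  have "inj_on \<mu> (N - {x})"
    using assignment_inj[OF \<mu>M] inj_on_subset by blast
  then have inj: "inj_on worst (N - {x})"
    using rest inj_on_cong[of "N - {x}" \<mu> worst] by simp
  have sw: "swap x y \<mu> \<in> B"
    using losers_swap[OF \<mu> x(1) y(1) xy] \<mu>M x y by (simp add: pref_worst)
  have secx: "\<mu> x = second_worst x"
    using last_two \<mu> x by blast
  \<comment> \<open>In the swapped loser it is \<open>y\<close> who is above the bottom, holding the
    former house of \<open>x\<close>.\<close>
  have secy: "\<mu> x = second_worst y"
    using last_two[OF sw y(1)] x bots by simp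
  have "worst z \<noteq> second_worst x" if "z \<in> N - {y, x}" for z
    using that rest[of z] secx assignment_eq_iff[OF \<mu>M x(1), of z] by auto
  then have "cond_iii n H P"
    \<comment> \<open>The roles are exchanged: injectivity is known away from \<open>x\<close>, so
      \<open>x\<close> instantiates the omitted agent of \<open>cond_iii\<close>.\<close>
    unfolding cond_iii_def worst_def[symmetric] second_worst_def[symmetric]
    using x(1) y(1) xy bots inj secx secy by (intro exI[of _ y] exI[of _ x]) simp
  moreover have "B = {\<mu>, swap x y \<mu>}"
  proof (rule equalityI; rule subsetI)
    fix \<nu> assume \<nu>: "\<nu> \<in> B"
    then obtain u where u: "u \<in> N" "\<nu> u \<noteq> worst u"
      using False by blast
    obtain v where v: "v \<in> N" "\<nu> v = worst u"
      using obtain_holder[of \<nu> "worst u"] \<nu> u worst_in_houses by auto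
    have uv: "u \<noteq> v" "worst v = worst u"
      using u v partner[OF \<nu> u v] by auto
    have rest': "\<nu> z = worst z" if "z \<in> N" "z \<noteq> u" for z
      using one_above_bottom[OF \<nu> u] that by blast
    have secu: "\<nu> u = second_worst u"
      using last_two \<nu> u by blast
    \<comment> \<open>Injectivity away from \<open>x\<close> makes \<open>u\<close> or
      \<open>v\<close> equal to \<open>x\<close>; if it is \<open>v\<close>, then \<open>u\<close>
      shares its worst house with \<open>y\<close> and equals it.\<close>
    have "u = x \<or> u = y"
      using inj uv u v x y xy bots unfolding inj_on_def by (metis DiffI singletonD)
    then show "\<nu> \<in> {\<mu>, swap x y \<mu>}"
    proof
      assume ux: "u = x"
      have "\<nu> = \<mu>"
      proof (rule assignment_eqI)
        fix z assume "z \<in> N"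
        then show "\<nu> z = \<mu> z"
          using rest[of z] rest'[of z] ux secu secx by (cases "z = x") auto
      qed (use \<nu> \<mu>M in auto)
      then show ?thesis
        by simp
    next
      assume uy: "u = y"
      have "\<nu> = swap x y \<mu>"
      proof (rule assignment_eqI)
        fix z assume "z \<in> N"
        then show "\<nu> z = swap x y \<mu> z"
          using rest[of z] rest'[of z] uy secu secy y xy
          by (cases "z = x"; cases "z = y") auto
      qed (use \<nu> sw in auto)
      then show ?thesis
        by simp
    qed
  qed (use \<mu> sw in auto)
  moreover have "\<mu> \<noteq> swap x y \<mu>"
    using x y by (metis swap_simps(1))
  ultimately show ?thesis
    by simp
qed

end

section \<open>The top cycle as the least nonempty separated set\<close>

context preference_profile
begin

lemma wins_pos:
  assumes "x \<in> N" "(\<mu> x, \<nu> x) \<in> P x"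
  shows "0 < wins \<mu> \<nu>"
  using assms by (auto simp: wins_def card_gt_0_iff)

lemma wins_le_1:
  assumes "\<And>x. \<lbrakk>x \<in> N; (\<mu> x, \<nu> x) \<in> P x\<rbrakk> \<Longrightarrow> x = y"
  shows "wins \<mu> \<nu> \<le> 1"
proof -
  have "wins \<mu> \<nu> \<le> card {y}"
    unfolding wins_def using assms by (intro card_mono) auto
  then show ?thesis
    by simp
qed

lemma wins_eq_0:
  assumes "\<And>x. x \<in> N \<Longrightarrow> (\<mu> x, \<nu> x) \<notin> P x"
  shows "wins \<mu> \<nu> = 0"
  using assms by (simp add: wins_def)

lemma wins_ge_2:
  assumes "x \<in> N" "z \<in> N" "x \<noteq> z" "(\<mu> x, \<nu> x) \<in> P x" "(\<mu> z, \<nu> z) \<in> P z"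
  shows "2 \<le> wins \<mu> \<nu>"
proof -
  have "card {x, z} \<le> wins \<mu> \<nu>"
    unfolding wins_def using assms by (intro card_mono) auto
  then show ?thesis
    using assms(3) by simp
qed

lemma card_weak_pref_agents:
  "card (weak_pref_agents n P \<mu> \<nu>) = wins \<mu> \<nu> + card {x \<in> N. \<mu> x = \<nu> x}"
proof -
  have "weak_pref_agents n P \<mu> \<nu> = {x \<in> N. (\<mu> x, \<nu> x) \<in> P x} \<union> {x \<in> N. \<mu> x = \<nu> x}"
    by (auto simp: weak_pref_agents_def)
  moreover have "{x \<in> N. (\<mu> x, \<nu> x) \<in> P x} \<inter> {x \<in> N. \<mu> x = \<nu> x} = {}"
    by auto
  ultimately show ?thesis
    unfolding wins_def by (simp add: card_Un_disjoint)
qed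

lemma maj_rel_iff: "(\<mu>, \<nu>) \<in> maj_rel n H P \<longleftrightarrow> \<mu> \<in> M \<and> \<nu> \<in> M \<and> wins \<nu> \<mu> \<le> wins \<mu> \<nu>"
  unfolding maj_rel_def card_weak_pref_agents by (auto simp: eq_commute)

abbreviation "TC \<equiv> top_cycle n H P"

text \<open>An assignment that ties or beats a member of the top cycle reaches everything through
  that member and so belongs to the cycle.\<close>

lemma top_cycle_separation: "separation n H P TC"
proof
  show "TC \<subseteq> M"
    by (auto simp: top_cycle_def)
  fix \<mu> \<nu> assume \<mu>: "\<mu> \<in> TC" and \<nu>: "\<nu> \<in> M - TC"
  show "wins \<nu> \<mu> < wins \<mu> \<nu>"
  proof (rule ccontr)
    assume "\<not> ?thesis"
    then have "(\<nu>, \<mu>) \<in> maj_rel n H P"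
      using \<mu> \<nu> by (auto simp: maj_rel_iff top_cycle_def)
    then have "\<nu> \<in> TC"
      using \<mu> \<nu> by (auto simp: top_cycle_def intro: trancl_into_trancl2)
    then show False
      using \<nu> by simp
  qed
qed

text \<open>An assignment reaching the most others reaches all: by totality of the majority
  relation, an unreached one would reach all of these and itself.\<close>

lemma top_cycle_nonempty: "TC \<noteq> {}"
proof -
  let ?R = "(maj_rel n H P)\<^sup>+"
  let ?f = "\<lambda>\<mu>. card {\<nu> \<in> M. (\<mu>, \<nu>) \<in> ?R}"
  have "finite (?f ` M)" "?f ` M \<noteq> {}"
    using finite_assignments assignments_nonempty by auto
  then have "Max (?f ` M) \<in> ?f ` M"
    by (rule Max_in)
  then obtain \<mu> where \<mu>: "Max (?f ` M) = ?f \<mu>" "\<mu> \<in> M"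
    by (rule imageE)
  have max: "?f \<nu> \<le> ?f \<mu>" if "\<nu> \<in> M" for \<nu>
    unfolding \<mu>(1)[symmetric] using that finite_assignments by (intro Max_ge imageI finite_imageI)
  have "(\<mu>, \<nu>) \<in> ?R" if \<nu>: "\<nu> \<in> M" for \<nu>
  proof (rule ccontr)
    assume no: "(\<mu>, \<nu>) \<notin> ?R"
    then have "(\<mu>, \<nu>) \<notin> maj_rel n H P"
      by blast
    then have "(\<nu>, \<mu>) \<in> maj_rel n H P"
      using \<mu>(2) \<nu> by (auto simp: maj_rel_iff)
    moreover have "(\<nu>, \<nu>) \<in> ?R"
      using \<nu> by (auto simp: maj_rel_iff)
    ultimately have "{\<xi> \<in> M. (\<mu>, \<xi>) \<in> ?R} \<subset> {\<xi> \<in> M. (\<nu>, \<xi>) \<in> ?R}"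
      using no \<nu> by (auto intro: trancl_into_trancl2)
    then have "?f \<mu> < ?f \<nu>"
      using finite_assignments by (intro psubset_card_mono) auto
    then show False
      using max[OF \<nu>] by simp
  qed
  then show ?thesis
    using \<mu>(2) by (auto simp: top_cycle_def)
qed

end

text \<open>No majority step leads from outside \<open>A\<close> into \<open>A\<close>, so whatever
  reaches a member of \<open>A\<close> lies in \<open>A\<close>.\<close>

lemma (in separation) top_cycle_subset:
  assumes "A \<noteq> {}"
  shows "TC \<subseteq> A"
proof
  fix \<mu> assume "\<mu> \<in> TC"
  moreover obtain \<nu> where \<nu>: "\<nu> \<in> A"
    using assms by blast
  ultimately have "(\<mu>, \<nu>) \<in> (maj_rel n H P)\<^sup>+"
    using A_subset by (auto simp: top_cycle_def)
  then show "\<mu> \<in> A"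
    using \<nu>
  proof (induction rule: trancl_induct)
    case (base \<nu>)
    then show ?case
      using A_wins[of \<nu> \<mu>] by (auto simp: maj_rel_iff)
  next
    case (step \<nu> \<xi>)
    then show ?case
      using A_wins[of \<xi> \<nu>] by (auto simp: maj_rel_iff)
  qed
qed

section \<open>Explicit losers under \<open>cond_iii\<close> and \<open>cond_iv\<close>\<close>

context preference_profile
begin

lemma assignment_of_inj:
  assumes "inj_on \<mu> N" "\<And>x. x \<in> N \<Longrightarrow> \<mu> x \<in> H" "\<And>x. x \<notin> N \<Longrightarrow> \<mu> x = undefined"
  shows "\<mu> \<in> M"
proof (rule assignmentI)
  show "\<mu> ` N = H"
    using assms by (intro card_subset_eq) (auto simp: card_image card_agents card_houses)
qed (rule assms)

text \<open>Nobody prefers holding her worst house to any alternative, while every other assignment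
  improves some agent.\<close>

lemma bottom_separation:
  assumes "cond_iv n H P"
  shows "\<exists>\<mu>\<in>M. separation n H P (M - {\<mu>})"
proof -
  let ?\<mu> = "\<lambda>x. if x \<in> N then worst x else undefined"
  have "inj_on worst N"
    using assms by (simp add: cond_iv_def worst_def)
  then have \<mu>: "?\<mu> \<in> M"
    using worst_in_houses by (intro assignment_of_inj) (auto simp: inj_on_def)
  have "separation n H P (M - {?\<mu>})"
  proof
    fix \<nu> \<xi> assume \<nu>: "\<nu> \<in> M - {?\<mu>}" and "\<xi> \<in> M - (M - {?\<mu>})"
    then have \<xi>: "\<xi> = ?\<mu>"
      by blast
    obtain x where x: "x \<in> N" "\<nu> x \<noteq> worst x"
      using \<nu> assignment_eqI[of \<nu> ?\<mu>] \<mu> by fastforce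
    have "wins \<xi> \<nu> = 0"
    proof (rule wins_eq_0)
      fix x assume "x \<in> N"
      then show "(\<xi> x, \<nu> x) \<notin> P x"
        using \<nu> \<xi> pref_asym[OF _ pref_worst, of x "\<nu> x"] by (cases "\<nu> x = worst x") auto
    qed
    moreover have "0 < wins \<nu> \<xi>"
      using x \<nu> \<xi> by (intro wins_pos[of x]) (auto simp: pref_worst)
    ultimately show "wins \<xi> \<nu> < wins \<nu> \<xi>"
      by simp
  qed auto
  then show ?thesis
    using \<mu> by blast
qed

text \<open>Only \<open>y\<close> can object to \<nu>, and only if \<nu> gives her the worst house.
  Then \<open>x\<close> has left that house, and a third agent has moved too, since otherwise \<nu>
  would be the swap: two votes against one.\<close>

lemma near_bottom_wins:
  assumes n: "2 \<le> n" and xy: "x \<in> N" "y \<in> N" "x \<noteq> y" and bots: "worst x = worst y"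
    and \<mu>: "\<mu> \<in> M" "\<mu> y = second_worst y" "\<And>z. \<lbrakk>z \<in> N; z \<noteq> y\<rbrakk> \<Longrightarrow> \<mu> z = worst z"
    and \<nu>: "\<nu> \<in> M" "\<nu> \<noteq> \<mu>" "\<nu> \<noteq> swap x y \<mu>"
  shows "wins \<mu> \<nu> < wins \<nu> \<mu>"
proof -
  have lose: "z = y \<and> \<nu> y = worst y" if "z \<in> N" "(\<mu> z, \<nu> z) \<in> P z" for z
  proof -
    have H: "\<nu> z \<in> H"
      using \<nu> that by simp
    have "z = y"
      using that \<mu>(3)[of z] pref_worst[OF that(1) H] pref_asym[OF that(1)] pref_irrefl[OF that(1)] by metis
    moreover have "\<nu> y = worst y"
      using that \<open>z = y\<close> \<mu>(2) pref_second_worst[OF n xy(2), of "\<nu> y"] H pref_asym[OF xy(2)] pref_irrefl[OF xy(2)]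
      by metis
    ultimately show ?thesis
      by simp
  qed
  show ?thesis
  proof (cases "\<nu> y = worst y")
    case True
    have win: "(\<nu> z, \<mu> z) \<in> P z" if "z \<in> N" "z \<noteq> y" "\<nu> z \<noteq> \<mu> z" for z
      using that \<mu>(3)[of z] \<nu>(1) pref_worst by simp
    have "\<nu> x \<noteq> \<mu> x"
      using True \<mu>(3)[of x] xy bots assignment_eq_iff[OF \<nu>(1) xy(1,2)] by auto
    moreover have "\<exists>z\<in>N - {x, y}. \<nu> z \<noteq> \<mu> z"
    proof (rule ccontr)
      assume "\<not> ?thesis"
      then have same: "\<nu> z = \<mu> z" if "z \<in> N" "z \<noteq> x" "z \<noteq> y" for z
        using that by blast
      obtain z where z: "z \<in> N" "\<mu> z = \<nu> x"
        using obtain_holder[OF \<mu>(1)] \<nu>(1) xy(1) by (metis assignment_in_houses)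
      have "z = y"
        using same[of z] z \<open>\<nu> x \<noteq> \<mu> x\<close> assignment_eq_iff[OF \<nu>(1) z(1) xy(1)] by auto
      have "\<nu> = swap x y \<mu>"
      proof (rule assignment_eqI[OF \<nu>(1)])
        fix u assume "u \<in> N"
        then show "\<nu> u = swap x y \<mu> u"
          using same[of u] z \<open>z = y\<close> True bots \<mu>(3)[of x] xy by (cases "u = x"; cases "u = y") auto
      qed (use \<mu> xy in auto)
      then show False
        using \<nu>(3) by simp
    qed
    ultimately have "2 \<le> wins \<nu> \<mu>"
      using win xy by (auto intro: wins_ge_2)
    moreover have "wins \<mu> \<nu> \<le> 1"
      using lose by (intro wins_le_1[of _ _ y]) blast
    ultimately show ?thesis
      by simp
  next
    case False
    obtain z where z: "z \<in> N" "\<nu> z \<noteq> \<mu> z"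
      using assignment_eqI[OF \<nu>(1) \<mu>(1)] \<nu>(2) by blast
    have "wins \<mu> \<nu> = 0"
      using lose False by (intro wins_eq_0) blast
    moreover have "0 < wins \<nu> \<mu>"
    proof (rule wins_pos[OF z(1)])
      show "(\<nu> z, \<mu> z) \<in> P z"
        using z \<nu>(1) \<mu> False pref_worst pref_second_worst[OF n] by (cases "z = y") auto
    qed
    ultimately show ?thesis
      by simp
  qed
qed

text \<open>All others sit at the bottom, and \<open>x\<close> and \<open>y\<close> divide their
  common last two houses in the two possible ways. Exchanging \<open>x\<close> and \<open>y\<close>
  in \<open>near_bottom_wins\<close> covers the second way.\<close>

lemma near_bottom_separation:
  assumes n: "2 \<le> n" and iii: "cond_iii n H P"
  shows "\<exists>\<mu>\<in>M. \<exists>\<nu>\<in>M. separation n H P (M - {\<mu>, \<nu>})"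
proof -
  obtain x y where xy: "x \<in> N" "y \<in> N" "x \<noteq> y" and bots: "worst x = worst y" and secs: "second_worst x = second_worst y"
    and inj: "inj_on worst (N - {y})" and out: "\<And>z. z \<in> N - {x, y} \<Longrightarrow> worst z \<noteq> second_worst x"
    using iii unfolding cond_iii_def worst_def[symmetric] second_worst_def[symmetric] by metis
  let ?\<mu> = "\<lambda>z. if z \<in> N then if z = y then second_worst y else worst z else undefined"
  have "inj_on ?\<mu> N"
  proof -
    have "worst z \<noteq> second_worst y" if "z \<in> N - {y}" for z
      using that out[of z] secs bots second_worst_neq_worst[OF n xy(2)] by (cases "z = x") auto
    then show ?thesis
      using inj unfolding inj_on_def by (metis (no_types, lifting) DiffI singletonD)
  qed
  then have \<mu>: "?\<mu> \<in> M"
    using worst_in_houses second_worst_in_houses[OF n] by (intro assignment_of_inj) auto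
  let ?\<nu> = "swap x y ?\<mu>"
  have \<nu>: "?\<nu> \<in> M"
    using \<mu> xy by simp
  have "separation n H P (M - {?\<mu>, ?\<nu>})"
  proof
    fix \<xi> \<zeta> assume \<xi>: "\<xi> \<in> M - {?\<mu>, ?\<nu>}" and "\<zeta> \<in> M - (M - {?\<mu>, ?\<nu>})"
    then consider "\<zeta> = ?\<mu>" | "\<zeta> = ?\<nu>"
      by blast
    then show "wins \<zeta> \<xi> < wins \<xi> \<zeta>"
    proof cases
      case 1
      then show ?thesis
        using \<xi> xy bots \<mu> by (auto intro!: near_bottom_wins[OF n, of x y])
    next
      case 2
      have "swap y x ?\<nu> = ?\<mu>"
        by (simp add: swap_commute[of y x])
      moreover have "?\<nu> z = worst z" if "z \<in> N" "z \<noteq> x" for z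
        using that bots xy by (cases "z = y") auto
      moreover have "?\<nu> x = second_worst x"
        using xy secs by simp
      ultimately show ?thesis
        unfolding 2 using \<xi> xy bots \<nu> by (intro near_bottom_wins[OF n, of y x]) auto
    qed
  qed auto
  then show ?thesis
    using \<mu> \<nu> by blast
qed

end

section \<open>Counting assignments and reversing preferences\<close>

context preference_profile
begin

text \<open>Composing one fixed assignment with the permutations of \<open>N\<close> yields each
  assignment exactly once.\<close>

lemma card_assignments: "card M = fact n"
proof -
  obtain \<mu> where \<mu>: "\<mu> \<in> M"
    using assignments_nonempty by blast
  have "bij_betw (\<lambda>p. \<mu> \<circ> p) {p. p permutes N} M"
  proof (rule bij_betwI')
    fix p q assume "p \<in> {p. p permutes N}" "q \<in> {p. p permutes N}"
    then have p: "p permutes N" and q: "q permutes N"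
      by simp_all
    show "(\<mu> \<circ> p = \<mu> \<circ> q) = (p = q)"
    proof
      assume eq: "\<mu> \<circ> p = \<mu> \<circ> q"
      show "p = q"
      proof
        fix x
        show "p x = q x"
        proof (cases "x \<in> N")
          case True
          then show ?thesis
            using eq \<mu> p q by (metis assignment_eq_iff comp_apply permutes_in_image)
        qed (use p q in \<open>simp add: permutes_not_in\<close>)
      qed
    qed simp
  next
    fix p assume "p \<in> {p. p permutes N}"
    then have p: "p permutes N"
      by simp
    show "\<mu> \<circ> p \<in> M"
    proof (rule assignmentI)
      show "(\<mu> \<circ> p) ` N = H"
        using assignment_image[OF \<mu>] permutes_image[OF p] by (metis image_comp)
    qed (use p \<mu> in \<open>simp add: permutes_not_in assignment_undefined\<close>)
  next
    fix \<nu> assume \<nu>: "\<nu> \<in> M"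
    \<comment> \<open>Outside \<open>N\<close> the identity is needed for \<open>permutes\<close>,
      although assignments are \<open>undefined\<close> there.\<close>
    define p where "p x = (if x \<in> N then inv_into N \<mu> (\<nu> x) else x)" for x
    have bij: "bij_betw \<mu> N H" "bij_betw \<nu> N H"
      using \<mu> \<nu> by (simp_all add: assignments_def)
    have "bij_betw (inv_into N \<mu> \<circ> \<nu>) N N"
      using bij by (meson bij_betw_inv_into bij_betw_trans)
    then have "bij_betw p N N"
      by (rule bij_betw_cong[THEN iffD1, rotated]) (simp add: p_def)
    then have "p permutes N"
      by (rule bij_imp_permutes) (simp add: p_def)
    moreover have "\<nu> = \<mu> \<circ> p"
    proof
      fix x show "\<nu> x = (\<mu> \<circ> p) x"
        using \<nu> \<mu> bij by (cases "x \<in> N")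
          (auto simp: p_def assignment_undefined bij_betw_inv_into_right)
    qed
    ultimately show "\<exists>p\<in>{p. p permutes N}. \<nu> = \<mu> \<circ> p"
      by blast
  qed
  then have "card M = card {p. p permutes N}"
    by (simp add: bij_betw_same_card)
  then show ?thesis
    by (simp add: card_permutations[OF card_agents])
qed

lemma converse_profile: "preference_profile n H (\<lambda>x. (P x)\<inverse>)"
proof
  have "(P x)\<inverse> \<subseteq> H \<times> H" if "x \<in> N" for x
    using profile that unfolding is_profile_def by blast
  moreover have "strict_linear_order_on H ((P x)\<inverse>)" if "x \<in> N" for x
    using profile that by (simp add: is_profile_def strict_linear_order_on_def irrefl_def)
  ultimately show "is_profile n H (\<lambda>x. (P x)\<inverse>)"
    using profile by (simp add: is_profile_def)
qed

end

lemma cond_converse [simp]: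
  "cond_iv n H (\<lambda>x. (P x)\<inverse>) = cond_i n H P" "cond_iii n H (\<lambda>x. (P x)\<inverse>) = cond_ii n H P"
proof -
  have bot: "bot_of (R\<inverse>) S = top_of R S" for R :: "('h \<times> 'h) set" and S
    by (simp add: bot_of_def top_of_def)
  have "bottom_choice H (\<lambda>x. (P x)\<inverse>) = top_choice H P"
    "second_last_choice H (\<lambda>x. (P x)\<inverse>) = second_choice H P"
    by (simp_all add: bottom_choice_def top_choice_def second_last_choice_def second_choice_def bot fun_eq_iff)
  then show "cond_iv n H (\<lambda>x. (P x)\<inverse>) = cond_i n H P" "cond_iii n H (\<lambda>x. (P x)\<inverse>) = cond_ii n H P"
    by (simp_all add: cond_iv_def cond_i_def cond_iii_def cond_ii_def)
qed

text \<open>Reversal exchanges the arguments of \<open>wins\<close>, so the complement becomes the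
  winning side.\<close>

lemma (in preference_profile) separation_converse:
  assumes "X \<subseteq> M"
  shows "separation n H (\<lambda>x. (P x)\<inverse>) (M - X) \<longleftrightarrow> separation n H P X"
proof -
  have wins: "preference_profile.wins n (\<lambda>x. (P x)\<inverse>) \<mu> \<nu> = wins \<nu> \<mu>" for \<mu> \<nu>
    using preference_profile.wins_def[OF converse_profile] by (simp add: wins_def)
  show ?thesis
    using assms preference_profile_axioms converse_profile
    by (auto simp: separation_def separation_axioms_def wins)
qed

context separation
begin

lemma few_losers_cases:
  assumes "5 \<le> n" "A \<noteq> M"
    and "\<And>T \<mu>. \<lbrakk>T \<subseteq> N; card T = 3; \<mu> \<in> M\<rbrakk> \<Longrightarrow> card (coset \<mu> T \<inter> (M - A)) \<le> 2"
  shows "cond_iv n H P \<and> card (M - A) = 1 \<or> cond_iii n H P \<and> card (M - A) = 2"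
proof -
  interpret few_losers n H P A
    by unfold_locales (use assms in auto)
  show ?thesis
    using losers_cases assms(2) A_subset by blast
qed

text \<open>For reversed preferences the set \<open>A\<close> consists of the losers, so
  \<open>few_losers_cases\<close> applies.\<close>

lemma few_winners_cases:
  assumes "5 \<le> n" "A \<noteq> {}"
    and few: "\<And>T \<mu>. \<lbrakk>T \<subseteq> N; card T = 3; \<mu> \<in> M\<rbrakk> \<Longrightarrow> card (coset \<mu> T \<inter> A) \<le> 2"
  shows "cond_i n H P \<and> card A = 1 \<or> cond_ii n H P \<and> card A = 2"
proof -
  have MA: "M - (M - A) = A" "M - A \<noteq> M"
    using A_subset assms(2) by blast+
  interpret conv: separation n H "\<lambda>x. (P x)\<inverse>" "M - A"
    using separation_converse[OF A_subset] separation_axioms by blast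
  show ?thesis
    using conv.few_losers_cases[OF assms(1) MA(2)] few unfolding MA by simp
qed

end

section \<open>Assembling the cases\<close>

theorem theorem4p4:
  fixes n :: nat and H :: "'h set" and P :: "nat \<Rightarrow> ('h \<times> 'h) set"
  assumes "n \<ge> 5" and "is_profile n H P"
  shows "card (top_cycle n H P) \<in> {1, 2, fact n - 2, fact n - 1, fact n}
    \<and> (cond_i n H P \<longrightarrow> card (top_cycle n H P) = 1)
    \<and> (cond_ii n H P \<longrightarrow> card (top_cycle n H P) = 2)
    \<and> (\<not> cond_i n H P \<and> \<not> cond_ii n H P \<and> cond_iii n H P
         \<longrightarrow> card (top_cycle n H P) = fact n - 2)
    \<and> (\<not> cond_i n H P \<and> \<not> cond_ii n H P \<and> cond_iv n H P
         \<longrightarrow> card (top_cycle n H P) = fact n - 1)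
    \<and> (\<not> cond_i n H P \<and> \<not> cond_ii n H P \<and> \<not> cond_iii n H P \<and> \<not> cond_iv n H P
         \<longrightarrow> card (top_cycle n H P) = fact n)"
proof -
  interpret preference_profile n H P
    by unfold_locales (rule assms)
  interpret TC: separation n H P TC
    by (rule top_cycle_separation)
  interpret conv: preference_profile n H "\<lambda>x. (P x)\<inverse>"
    by (rule converse_profile)
  have TCM: "TC \<subseteq> M" and fin: "finite TC"
    using TC.A_subset finite_assignments finite_subset by blast+
  \<comment> \<open>The bound 5! = 120 later guarantees an assignment besides any two given
    ones.\<close>
  have "fact 5 \<le> (fact n :: nat)"
    using assms(1) by (rule fact_mono)
  then have big: "120 \<le> card M" and cardM: "card M = fact n"
    by (simp_all add: card_assignments fact_numeral)
  have "card (M - TC) = fact n - card TC" and "card TC \<le> fact n"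
    using TCM fin finite_assignments cardM by (auto simp: card_Diff_subset card_mono simp flip: cardM)
  then have cardTC: "card TC = fact n - card (M - TC)"
    by simp
  have i: "card TC = 1" if c: "cond_i n H P"
  proof -
    obtain \<mu> where \<mu>: "\<mu> \<in> M" "separation n H P {\<mu>}"
      \<comment> \<open>Under reversal the unique loser of \<open>cond_iv\<close> becomes the unique
        winner of \<open>cond_i\<close>.\<close>
      using conv.bottom_separation c separation_converse by auto
    then have "TC \<subseteq> {\<mu>}"
      by (intro separation.top_cycle_subset) auto
    then show ?thesis
      using top_cycle_nonempty by (auto simp: subset_singleton_iff)
  qed
  have ii: "card TC = 2" if c: "cond_ii n H P"
  proof -
    obtain \<mu> \<nu> where "\<mu> \<in> M" "\<nu> \<in> M" "separation n H P {\<mu>, \<nu>}"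
      using conv.near_bottom_separation c separation_converse assms(1) by auto
    then have "TC \<subseteq> {\<mu>, \<nu>}"
      by (intro separation.top_cycle_subset) auto
    then have "card TC \<le> card {\<mu>, \<nu>}"
      by (intro card_mono) auto
    also have "\<dots> \<le> 2"
      by (simp add: card_insert_if)
    finally have "card TC \<le> 2" .
    \<comment> \<open>Minimality gives only an upper bound; equality follows from
      \<open>few_winners_cases\<close>, as \<open>cond_i\<close> fails.\<close>
    then have "card (coset \<mu> T \<inter> TC) \<le> 2" for \<mu> T
      using card_mono[OF fin, of "coset \<mu> T \<inter> TC"] by auto
    moreover have "\<not> cond_i n H P"
      using c by (auto simp: cond_i_def cond_ii_def inj_on_def)
    ultimately show ?thesis
      using TC.few_winners_cases[OF assms(1) top_cycle_nonempty] by blast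
  qed
  have proper: "TC \<noteq> M" if c: "cond_iii n H P \<or> cond_iv n H P"
  proof -
    have "\<exists>\<mu>\<in>M. \<exists>\<nu>\<in>M. separation n H P (M - {\<mu>, \<nu>})"
      using c
    proof
      assume "cond_iii n H P"
      then show ?thesis
        using near_bottom_separation assms(1) by simp
    next
      assume "cond_iv n H P"
      then obtain \<mu> where "\<mu> \<in> M" "separation n H P (M - {\<mu>})"
        using bottom_separation by blast
      then show ?thesis
        \<comment> \<open>The same assignment serves as both removed elements.\<close>
        by (intro bexI[of _ \<mu>]) simp_all
    qed
    then obtain \<mu> \<nu> where \<mu>\<nu>: "\<mu> \<in> M" "\<nu> \<in> M" "separation n H P (M - {\<mu>, \<nu>})"
      by blast
    have "card {\<mu>, \<nu>} < card M"
      using big by (cases "\<mu> = \<nu>") auto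
    then have "M - {\<mu>, \<nu>} \<noteq> {}"
      using card_mono[of "{\<mu>, \<nu>}" M] by auto
    then show ?thesis
      using separation.top_cycle_subset[OF \<mu>\<nu>(3)] \<mu>\<nu>(1) by blast
  qed
  \<comment> \<open>This keeps the cardinalities for one and for two losers apart in the last
    case.\<close>
  have excl: "\<not> (cond_iii n H P \<and> cond_iv n H P)"
    by (auto simp: cond_iii_def cond_iv_def inj_on_def)
  consider (few_losers) "\<forall>T \<mu>. T \<subseteq> N \<longrightarrow> card T = 3 \<longrightarrow> \<mu> \<in> M \<longrightarrow> card (coset \<mu> T \<inter> (M - TC)) \<le> 2"
    | (few_winners) "\<forall>T \<mu>. T \<subseteq> N \<longrightarrow> card T = 3 \<longrightarrow> \<mu> \<in> M \<longrightarrow> card (coset \<mu> T \<inter> TC) \<le> 2"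
    using TC.small_cosets_cases assms(1) by force
  then show ?thesis
  proof cases
    case few_winners
    then have "cond_i n H P \<and> card TC = 1 \<or> cond_ii n H P \<and> card TC = 2"
      using TC.few_winners_cases[OF assms(1) top_cycle_nonempty] by blast
    \<comment> \<open>Here \<open>cond_i\<close> or \<open>cond_ii\<close> holds, so the clauses
      that negate both are vacuous.\<close>
    then show ?thesis
      using i ii by auto
  next
    case few_losers
    then have "TC = M \<or> cond_iv n H P \<and> card (M - TC) = 1 \<or> cond_iii n H P \<and> card (M - TC) = 2"
      using TC.few_losers_cases[OF assms(1)] by blast
    then have "TC = M \<and> card TC = fact n \<or> cond_iv n H P \<and> card TC = fact n - 1
        \<or> cond_iii n H P \<and> card TC = fact n - 2"
      using cardTC cardM by metis
    then show ?thesis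
      using i ii proper excl by auto
  qed
qed

end
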